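(* Let $I=[x,x+y]\subset[0,\infty)$ with $y>0$. Then for every non-negative $f\in W^{1,1}(I)$ with $\rho_I(f)>1$, \[ \sum_{p\in I} f(p) < \frac{2\,\|f\|_{1,I}}{\log \rho_I(f)}, \] where the sum runs over primes $p$.
   Context: $W^{1,1}(I)$ denotes the closure of $C^1(I)$ with respect to the norm $\|f\|_{1,I}+\|f'\|_{1,I}$, where $\|g\|_{1,I}=\int_I|g(t)|\,dt$; it is regarded as a subspace of $C^0(I)$. $\|f\|_{\infty,I}=\sup_{t\in I}|f(t)|$. The functional $\rho_I\colon W^{1,1}(I)\to[0,\infty)$ is defined by $\rho_I(f)=\|f\|_{1,I}/(\|f\|_{\infty,I}+\|f'\|_{1,I})$ for $f\neq 0$ and $\rho_I(0)=0$. *)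

theory Defs
  imports "HOL-Analysis.Analysis" "HOL-Computational_Algebra.Primes"
begin

definition L1norm :: "real set \<Rightarrow> (real \<Rightarrow> real) \<Rightarrow> real" where
  "L1norm I g = integral I (\<lambda>t. \<bar>g t\<bar>)"

definition supnorm :: "real set \<Rightarrow> (real \<Rightarrow> real) \<Rightarrow> real" where
  "supnorm I g = Sup ((\<lambda>t. \<bar>g t\<bar>) ` I)"

definition C1_with_deriv :: "real set \<Rightarrow> (real \<Rightarrow> real) \<Rightarrow> (real \<Rightarrow> real) \<Rightarrow> bool" where
  "C1_with_deriv I g D \<longleftrightarrow>
     (\<forall>t\<in>I. (g has_real_derivative D t) (at t within I)) \<and> continuous_on I D"

text \<open>f belongs to W^{1,1}(I) (as a continuous function on I), with derivative h:
  f is the limit of C^1(I) functions g_n in the norm ||.||_1 + ||(.)'||_1,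
  the derivatives g_n' converging in L^1 to h.\<close>
definition W11 :: "real set \<Rightarrow> (real \<Rightarrow> real) \<Rightarrow> (real \<Rightarrow> real) \<Rightarrow> bool" where
  "W11 I f h \<longleftrightarrow> continuous_on I f \<and> h absolutely_integrable_on I \<and>
     (\<exists>g D. (\<forall>n. C1_with_deriv I (g n) (D n)) \<and>
        (\<lambda>n. L1norm I (\<lambda>t. g n t - f t) + L1norm I (\<lambda>t. D n t - h t)) \<longlonglongrightarrow> 0)"

definition rho :: "real set \<Rightarrow> (real \<Rightarrow> real) \<Rightarrow> (real \<Rightarrow> real) \<Rightarrow> real" where
  "rho I f h = (if (\<forall>t\<in>I. f t = 0) then 0
               else L1norm I f / (supnorm I f + L1norm I h))"

end

theory Submission
  imports Defs
begin

text \<open>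
  With \<open>E = \<parallel>f\<parallel>\<^sub>\<infinity> + \<parallel>h\<parallel>\<^sub>1\<close>, partial summation turns any set of integers that is equidistributed
  with density \<open>\<alpha>\<close> and discrepancy \<open>\<delta>\<close> into the estimate \<open>\<alpha> \<parallel>f\<parallel>\<^sub>1\<close> for the sum of \<open>f\<close> over it, with an
  error of at most \<open>2 \<delta> E\<close>, so the claim is an inequality in \<open>\<rho> = \<parallel>f\<parallel>\<^sub>1 / E\<close> alone. For \<open>\<rho> \<le> 30\<close>
  it suffices that all primes but \<open>2\<close> are odd, and for \<open>\<rho> \<le> 1024\<close> that all but \<open>2, 3, 5\<close> are coprime
  to \<open>30\<close>. For larger \<open>\<rho>\<close> Selberg's sieve is applied to the integers coprime to \<open>30\<close> with level
  \<open>R = 11 / 32 * sqrt \<rho>\<close>. The main term is \<open>4/15 \<parallel>f\<parallel>\<^sub>1 / L\<close> with \<open>L \<ge> 4/15 (ln R + const)\<close>; the error is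
  \<open>28/15 E (\<Sum>\<bar>\<lambda>\<^sub>d\<bar>)\<^sup>2\<close>, and the exact formula \<open>\<Sum>\<bar>\<lambda>\<^sub>d\<bar> = (\<Sum> \<sigma>(d)/\<phi>(d)) / L = O(R / ln R)\<close> saves
  the two logarithms that make it smaller than what the constant in \<open>L\<close> gains.
\<close>

section \<open>Sobolev functions and equidistributed sets\<close>

lemma C1_abel_summation:
  fixes g D :: "real \<Rightarrow> real" and T :: "nat set"
  assumes ab: "a \<le> b" and C1: "C1_with_deriv {a..b} g D"
    and fin: "finite T" and T: "real ` T \<subseteq> {a..b}"
  shows "(\<Sum>n\<in>T. g (real n)) - \<beta> * integral {a..b} g =
    g b * (real (card T) + e - \<beta> * b) - g a * (e - \<beta> * a)
      - integral {a..b} (\<lambda>t. D t * (real (card {n\<in>T. real n \<le> t}) + e - \<beta> * t))"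
proof -
  have der: "(g has_real_derivative D t) (at t within {a..b})" if "t \<in> {a..b}" for t
    using C1 that by (auto simp: C1_with_deriv_def)
  have contg: "continuous_on {a..b} g"
    by (rule DERIV_continuous_on) (use der in auto)
  have FTC: "(D has_integral g b - g s) {s..b}" if "s \<in> {a..b}" for s
  proof (rule fundamental_theorem_of_calculus)
    show "s \<le> b" using that by auto
    fix t assume "t \<in> {s..b}"
    then have "t \<in> {a..b}" using that by auto
    from der[OF this] show "(g has_vector_derivative D t) (at t within {s..b})"
      using that by (auto simp: has_real_derivative_iff_has_vector_derivative
          intro: has_vector_derivative_within_subset)
  qed
  have ind: "((\<lambda>t. if real n \<le> t then D t else 0) has_integral g b - g (real n)) {a..b}"
    if "n \<in> T" for n
  proof -
    have n: "real n \<in> {a..b}" using T that by auto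
    have "((\<lambda>t. if t \<in> {real n..b} then D t else 0) has_integral g b - g (real n)) {a..b}"
      by (subst has_integral_restrict) (use FTC[OF n] n in auto)
    then show ?thesis
      by (rule has_integral_eq[rotated]) auto
  qed
  have "((\<lambda>t. \<Sum>n\<in>T. if real n \<le> t then D t else 0) has_integral (\<Sum>n\<in>T. g b - g (real n))) {a..b}"
    by (intro has_integral_sum fin ind)
  moreover have "(\<Sum>n\<in>T. if real n \<le> t then D t else 0) = D t * real (card {n\<in>T. real n \<le> t})" for t
    using fin by (simp add: sum.If_cases Int_def)
  ultimately have i1: "((\<lambda>t. D t * real (card {n\<in>T. real n \<le> t})) has_integral
      (\<Sum>n\<in>T. g b - g (real n))) {a..b}" by simp
  have i2: "((\<lambda>t. e * D t) has_integral e * (g b - g a)) {a..b}"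
    using FTC[of a] ab by (intro has_integral_mult_right) auto
  have "((\<lambda>t. g t * 1 + D t * t) has_integral (g b * b - g a * a)) {a..b}"
  proof (rule fundamental_theorem_of_calculus[OF ab])
    fix t assume "t \<in> {a..b}"
    from der[OF this]
    show "((\<lambda>t. g t * t) has_vector_derivative (g t * 1 + D t * t)) (at t within {a..b})"
      unfolding has_real_derivative_iff_has_vector_derivative[symmetric]
      by (auto intro!: derivative_eq_intros)
  qed
  from has_integral_diff[OF this integrable_integral[OF integrable_continuous_real[OF contg]]]
  have i3: "((\<lambda>t. \<beta> * (D t * t)) has_integral \<beta> * (g b * b - g a * a - integral {a..b} g)) {a..b}"
    by (intro has_integral_mult_right) simp
  have "((\<lambda>t. D t * (real (card {n\<in>T. real n \<le> t}) + e - \<beta> * t)) has_integral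
      (\<Sum>n\<in>T. g b - g (real n)) + e * (g b - g a) - \<beta> * (g b * b - g a * a - integral {a..b} g)) {a..b}"
    using has_integral_diff[OF has_integral_add[OF i1 i2] i3] by (simp add: algebra_simps)
  then show ?thesis
    by (simp add: integral_unique sum_subtractf algebra_simps)
qed

lemma C1_discrepancy_bound:
  fixes g D :: "real \<Rightarrow> real" and T :: "nat set"
  assumes ab: "a \<le> b" and C1: "C1_with_deriv {a..b} g D"
    and fin: "finite T" and T: "real ` T \<subseteq> {a..b}"
    and e: "\<bar>e - \<beta> * a\<bar> \<le> \<delta>"
    and disc: "\<And>t. t \<in> {a..b} \<Longrightarrow> \<bar>real (card {n\<in>T. real n \<le> t}) + e - \<beta> * t\<bar> \<le> \<delta>"
  shows "\<bar>(\<Sum>n\<in>T. g (real n)) - \<beta> * integral {a..b} g\<bar>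
    \<le> \<delta> * (\<bar>g a\<bar> + \<bar>g b\<bar> + L1norm {a..b} D)"
proof -
  let ?d = "\<lambda>t. real (card {n\<in>T. real n \<le> t}) + e - \<beta> * t"
  have contD: "continuous_on {a..b} D" using C1 by (auto simp: C1_with_deriv_def)
  have i: "(\<lambda>t. \<delta> * \<bar>D t\<bar>) integrable_on {a..b}"
    by (intro integrable_continuous_real continuous_intros contD)
  have "\<bar>integral {a..b} (\<lambda>t. D t * ?d t)\<bar> \<le> \<delta> * L1norm {a..b} D"
  proof (cases "(\<lambda>t. D t * ?d t) integrable_on {a..b}")
    case True
    have "norm (integral {a..b} (\<lambda>t. D t * ?d t)) \<le> integral {a..b} (\<lambda>t. \<delta> * \<bar>D t\<bar>)"
      using i True disc by (intro integral_norm_bound_integral)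
        (auto simp: abs_mult mult.commute[of \<delta>] intro!: mult_left_mono)
    then show ?thesis by (simp add: L1norm_def)
  next
    case False
    have "L1norm {a..b} D \<ge> 0" unfolding L1norm_def by (rule integral_nonneg)
        (auto intro!: integrable_continuous_real continuous_intros contD)
    moreover have "\<delta> \<ge> 0" using e by linarith
    ultimately show ?thesis using False by (simp add: not_integrable_integral)
  qed
  moreover have "{n\<in>T. real n \<le> b} = T" using T by auto
  then have "\<bar>g b * (real (card T) + e - \<beta> * b)\<bar> \<le> \<delta> * \<bar>g b\<bar>"
    using disc[of b] ab by (auto simp: abs_mult mult.commute[of \<delta>] intro!: mult_left_mono)
  moreover have "\<bar>g a * (e - \<beta> * a)\<bar> \<le> \<delta> * \<bar>g a\<bar>"
    using e by (auto simp: abs_mult mult.commute[of \<delta>] intro!: mult_left_mono)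
  ultimately show ?thesis
    unfolding C1_abel_summation[OF ab C1 fin T, of \<beta> e] distrib_left by linarith
qed

lemma L1norm_le_add:
  assumes "u absolutely_integrable_on I" "v absolutely_integrable_on I" "w absolutely_integrable_on I"
    and le: "\<And>t. t \<in> I \<Longrightarrow> \<bar>u t\<bar> \<le> \<bar>v t\<bar> + \<bar>w t\<bar>"
  shows "L1norm I u \<le> L1norm I v + L1norm I w"
proof -
  have "(\<lambda>t. \<bar>u t\<bar>) integrable_on I" "(\<lambda>t. \<bar>v t\<bar>) integrable_on I" "(\<lambda>t. \<bar>w t\<bar>) integrable_on I"
    using assms by (simp_all add: absolutely_integrable_on_def)
  then show ?thesis
    unfolding L1norm_def by (subst integral_add[symmetric]) (auto intro!: integral_le integrable_add le)
qed

text \<open>Averaging over the base point bounds the supremum by the norm of the Sobolev space.\<close>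
lemma C1_sup_bound:
  assumes ab: "a < b" and C1: "C1_with_deriv {a..b} g D" and s: "s \<in> {a..b}"
  shows "\<bar>g s\<bar> \<le> L1norm {a..b} g / (b - a) + L1norm {a..b} D"
proof -
  have der: "(g has_real_derivative D t) (at t within {a..b})" if "t \<in> {a..b}" for t
    using C1 that by (auto simp: C1_with_deriv_def)
  have contD: "continuous_on {a..b} D" using C1 by (auto simp: C1_with_deriv_def)
  have contg: "continuous_on {a..b} g"
    by (rule DERIV_continuous_on) (use der in auto)
  have iD: "(\<lambda>t. \<bar>D t\<bar>) integrable_on {a..b}"
    by (intro integrable_continuous_real continuous_intros contD)
  have *: "\<bar>g v - g u\<bar> \<le> L1norm {a..b} D" if "u \<in> {a..b}" "v \<in> {a..b}" "u \<le> v" for u v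
  proof -
    have sub: "{u..v} \<subseteq> {a..b}" using that by auto
    have "(D has_integral g v - g u) {u..v}"
    proof (rule fundamental_theorem_of_calculus[OF that(3)])
      fix t assume "t \<in> {u..v}"
      with der[of t] sub show "(g has_vector_derivative D t) (at t within {u..v})"
        by (auto simp: has_real_derivative_iff_has_vector_derivative
            intro: has_vector_derivative_within_subset)
    qed
    then have "g v - g u = integral {u..v} D" by (simp add: integral_unique)
    also have "\<bar>\<dots>\<bar> \<le> integral {u..v} (\<lambda>t. \<bar>D t\<bar>)"
      using integral_norm_bound_integral[of D "{u..v}" "\<lambda>t. \<bar>D t\<bar>"]
        continuous_on_subset[OF contD sub]
      by (auto intro!: integrable_continuous_real continuous_intros)
    also have "\<dots> \<le> L1norm {a..b} D"
      unfolding L1norm_def using sub iD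
      by (intro integral_subset_le) (auto intro: integrable_on_subinterval)
    finally show ?thesis .
  qed
  have ptw: "\<bar>g s\<bar> \<le> \<bar>g t\<bar> + L1norm {a..b} D" if "t \<in> {a..b}" for t
    using *[of s t] *[of t s] s that by (cases "s \<le> t") linarith+
  have "integral {a..b} (\<lambda>t. \<bar>g s\<bar>) \<le> integral {a..b} (\<lambda>t. \<bar>g t\<bar> + L1norm {a..b} D)"
    by (intro integral_le integrable_continuous_real continuous_intros contg ptw)
  also have "\<dots> = L1norm {a..b} g + integral {a..b} (\<lambda>t. L1norm {a..b} D)"
    unfolding L1norm_def
    by (subst integral_add) (auto intro!: integrable_continuous_real continuous_intros contg)
  finally have "(b - a) * \<bar>g s\<bar> \<le> L1norm {a..b} g + (b - a) * L1norm {a..b} D"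
    using ab by simp
  then show ?thesis using ab by (simp add: field_simps)
qed

lemma C1_with_deriv_diff:
  "C1_with_deriv I g D \<Longrightarrow> C1_with_deriv I g' D' \<Longrightarrow>
    C1_with_deriv I (\<lambda>t. g t - g' t) (\<lambda>t. D t - D' t)"
  unfolding C1_with_deriv_def by (intro conjI ballI DERIV_diff continuous_on_diff) simp_all

lemma C1_with_deriv_continuous_on:
  assumes "C1_with_deriv I g D"
  shows "continuous_on I g" "continuous_on I D"
  using assms DERIV_continuous_on[of I g D] by (simp_all add: C1_with_deriv_def)

lemma continuous_absolutely_integrable:
  fixes g :: "real \<Rightarrow> real"
  assumes "continuous_on {a..b} g"
  shows "g absolutely_integrable_on {a..b}"
  using assms by (rule absolutely_integrable_continuous_real)

lemma L1norm_nonneg: "g absolutely_integrable_on I \<Longrightarrow> L1norm I g \<ge> 0"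
  unfolding L1norm_def by (rule integral_nonneg) (auto simp: absolutely_integrable_on_def)

lemma tendsto_integral_of_uniform_limit:
  fixes u :: "nat \<Rightarrow> real \<Rightarrow> real"
  assumes lim: "uniform_limit {a..b} u v sequentially" and cont: "\<And>n. continuous_on {a..b} (u n)"
  shows "(\<lambda>n. integral {a..b} (u n)) \<longlonglongrightarrow> integral {a..b} v"
proof -
  from uniform_limit_integral[OF lim cont sequentially_bot] obtain I J where
    "\<And>n. (u n has_integral I n) {a..b}" "(v has_integral J) {a..b}" "I \<longlonglongrightarrow> J"
    by blast
  moreover from this(1) have "I = (\<lambda>n. integral {a..b} (u n))"
    by (intro ext sym[OF integral_unique])
  ultimately show ?thesis by (simp add: integral_unique)
qed

lemma W11_approximation:
  assumes ab: "a < b" and W: "W11 {a..b} f h"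
  obtains g D where "\<And>n. C1_with_deriv {a..b} (g n) (D n)"
    "\<And>t. t \<in> {a..b} \<Longrightarrow> (\<lambda>n. g n t) \<longlonglongrightarrow> f t"
    "(\<lambda>n. integral {a..b} (g n)) \<longlonglongrightarrow> integral {a..b} f"
    "(\<lambda>n. L1norm {a..b} (D n)) \<longlonglongrightarrow> L1norm {a..b} h"
proof -
  let ?I = "{a..b}"
  have contf: "continuous_on ?I f" and ih: "h absolutely_integrable_on ?I"
    using W by (auto simp: W11_def)
  from W obtain g D where C1: "\<And>n. C1_with_deriv ?I (g n) (D n)"
    and lim: "(\<lambda>n. L1norm ?I (\<lambda>t. g n t - f t) + L1norm ?I (\<lambda>t. D n t - h t)) \<longlonglongrightarrow> 0"
    unfolding W11_def by blast
  note cont = C1_with_deriv_continuous_on[OF C1]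
  have igf: "(\<lambda>t. g n t - f t) absolutely_integrable_on ?I" for n
    by (intro continuous_absolutely_integrable continuous_intros cont contf)
  have iDh: "(\<lambda>t. D n t - h t) absolutely_integrable_on ?I" for n
    by (intro set_integral_diff(1) continuous_absolutely_integrable cont ih)
  have lim1: "(\<lambda>n. L1norm ?I (\<lambda>t. g n t - f t)) \<longlonglongrightarrow> 0"
    by (rule tendsto_sandwich[OF _ _ tendsto_const lim])
      (auto intro!: always_eventually L1norm_nonneg igf iDh)
  have lim2: "(\<lambda>n. L1norm ?I (\<lambda>t. D n t - h t)) \<longlonglongrightarrow> 0"
    by (rule tendsto_sandwich[OF _ _ tendsto_const lim])
      (auto intro!: always_eventually L1norm_nonneg igf iDh)
  have cauchy: "\<bar>g n s - g m s\<bar> \<le>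
      (1 / (b - a)) * (L1norm ?I (\<lambda>t. g n t - f t) + L1norm ?I (\<lambda>t. g m t - f t))
      + (L1norm ?I (\<lambda>t. D n t - h t) + L1norm ?I (\<lambda>t. D m t - h t))" (is "_ \<le> _ * ?X + ?Y")
    if "s \<in> ?I" for n m s
  proof -
    have "L1norm ?I (\<lambda>t. g n t - g m t) \<le> ?X"
      by (rule L1norm_le_add[OF _ igf igf])
        (auto intro!: continuous_absolutely_integrable continuous_intros cont)
    moreover have "L1norm ?I (\<lambda>t. D n t - D m t) \<le> ?Y"
      by (rule L1norm_le_add[OF _ iDh iDh])
        (auto intro!: continuous_absolutely_integrable continuous_intros cont)
    moreover have "L1norm ?I (\<lambda>t. g n t - g m t) / (b - a) \<le> ?X / (b - a)"
      using calculation(1) ab by (intro divide_right_mono) auto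
    ultimately show ?thesis
      using C1_sup_bound[OF ab C1_with_deriv_diff[OF C1 C1] that, of n m] by simp
  qed
  let ?q = "\<lambda>n. (1 / (b - a)) * L1norm ?I (\<lambda>t. g n t - f t) + L1norm ?I (\<lambda>t. D n t - h t)"
  have q: "?q \<longlonglongrightarrow> 0"
    using tendsto_add[OF tendsto_mult[OF tendsto_const[of "1/(b-a)"] lim1] lim2] by simp
  have "uniformly_Cauchy_on ?I g"
  proof (rule uniformly_Cauchy_onI)
    fix \<epsilon> :: real assume \<epsilon>: "\<epsilon> > 0"
    from order_tendstoD(2)[OF q, of "\<epsilon>/2"] \<epsilon> obtain N where N: "\<And>n. n \<ge> N \<Longrightarrow> ?q n < \<epsilon>/2"
      by (auto simp: eventually_sequentially)
    show "\<exists>M. \<forall>x\<in>?I. \<forall>m\<ge>M. \<forall>n\<ge>M. dist (g m x) (g n x) < \<epsilon>"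
    proof (intro exI ballI allI impI)
      fix s m n assume "s \<in> ?I" "m \<ge> N" "n \<ge> N"
      then show "dist (g m s) (g n s) < \<epsilon>"
        using cauchy[of s m n] N[of m] N[of n] unfolding dist_real_def distrib_left by linarith
    qed
  qed
  then obtain G where G: "uniform_limit ?I g G sequentially"
    by (auto simp: uniformly_convergent_on_def dest!: Cauchy_uniformly_convergent)
  have contG: "continuous_on ?I G"
    by (rule uniform_limit_theorem[OF always_eventually G]) (simp_all add: cont)
  have "uniform_limit ?I (\<lambda>n t. \<bar>g n t - f t\<bar>) (\<lambda>t. \<bar>G t - f t\<bar>) sequentially"
    using uniform_limit_norm[OF uniform_limit_minus[OF G uniform_limit_const[where c = f]]]
    by simp
  moreover have "continuous_on ?I (\<lambda>t. \<bar>g n t - f t\<bar>)" for n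
    by (intro continuous_on_rabs continuous_on_diff cont contf)
  ultimately have "(\<lambda>n. L1norm ?I (\<lambda>t. g n t - f t)) \<longlonglongrightarrow> integral ?I (\<lambda>t. \<bar>G t - f t\<bar>)"
    unfolding L1norm_def by (rule tendsto_integral_of_uniform_limit)
  with lim1 have zero: "integral ?I (\<lambda>t. \<bar>G t - f t\<bar>) = 0"
    using LIMSEQ_unique by fast
  have contGf: "continuous_on ?I (\<lambda>t. \<bar>G t - f t\<bar>)"
    by (intro continuous_on_rabs continuous_on_diff contG contf)
  have eq: "G t = f t" if "t \<in> ?I" for t
    using integral_eq_0_iff[OF contGf ab] zero that by simp
  show thesis
  proof (rule that[of g D])
    show "C1_with_deriv ?I (g n) (D n)" for n by (rule C1)
    show "(\<lambda>n. g n t) \<longlonglongrightarrow> f t" if "t \<in> ?I" for t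
      using tendsto_uniform_limitI[OF G that] eq[OF that] by simp
    have "(\<lambda>n. integral ?I (g n)) \<longlonglongrightarrow> integral ?I G"
      by (intro tendsto_integral_of_uniform_limit G) (auto intro: cont)
    also have "integral ?I G = integral ?I f"
      by (rule integral_cong) (use eq in auto)
    finally show "(\<lambda>n. integral ?I (g n)) \<longlonglongrightarrow> integral ?I f" .
    have iD: "D n absolutely_integrable_on ?I" for n
      by (intro continuous_absolutely_integrable cont)
    have "\<bar>L1norm ?I (D n) - L1norm ?I h\<bar> \<le> L1norm ?I (\<lambda>t. D n t - h t)" for n
      using L1norm_le_add[OF iD iDh ih, of n n] L1norm_le_add[OF ih iDh iD, of n n] by fastforce
    then have "(\<lambda>n. L1norm ?I (D n) - L1norm ?I h) \<longlonglongrightarrow> 0"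
      by (intro Lim_null_comparison[OF _ lim2] always_eventually) simp
    then show "(\<lambda>n. L1norm ?I (D n)) \<longlonglongrightarrow> L1norm ?I h"
      by (simp add: LIM_zero_cancel)
  qed
qed

lemma W11_discrepancy_bound:
  fixes f h :: "real \<Rightarrow> real" and T :: "nat set"
  assumes ab: "a < b" and W: "W11 {a..b} f h"
    and fin: "finite T" and T: "real ` T \<subseteq> {a..b}"
    and e: "\<bar>e - \<beta> * a\<bar> \<le> \<delta>"
    and disc: "\<And>t. t \<in> {a..b} \<Longrightarrow> \<bar>real (card {n\<in>T. real n \<le> t}) + e - \<beta> * t\<bar> \<le> \<delta>"
  shows "\<bar>(\<Sum>n\<in>T. f (real n)) - \<beta> * integral {a..b} f\<bar>
    \<le> \<delta> * (\<bar>f a\<bar> + \<bar>f b\<bar> + L1norm {a..b} h)"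
proof -
  from W11_approximation[OF ab W] obtain g D where C1: "\<And>n. C1_with_deriv {a..b} (g n) (D n)"
    and l1: "\<And>t. t \<in> {a..b} \<Longrightarrow> (\<lambda>n. g n t) \<longlonglongrightarrow> f t"
    and l2: "(\<lambda>n. integral {a..b} (g n)) \<longlonglongrightarrow> integral {a..b} f"
    and l3: "(\<lambda>n. L1norm {a..b} (D n)) \<longlonglongrightarrow> L1norm {a..b} h" by blast
  show ?thesis
  proof (rule LIMSEQ_le)
    show "(\<lambda>k. \<bar>(\<Sum>n\<in>T. g k (real n)) - \<beta> * integral {a..b} (g k)\<bar>) \<longlonglongrightarrow>
        \<bar>(\<Sum>n\<in>T. f (real n)) - \<beta> * integral {a..b} f\<bar>"
      using T by (intro tendsto_intros l1 l2) auto
    show "(\<lambda>k. \<delta> * (\<bar>g k a\<bar> + \<bar>g k b\<bar> + L1norm {a..b} (D k))) \<longlonglongrightarrow>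
        \<delta> * (\<bar>f a\<bar> + \<bar>f b\<bar> + L1norm {a..b} h)"
      using ab by (intro tendsto_intros l1 l3) auto
  qed (use C1_discrepancy_bound[OF less_imp_le[OF ab] C1 fin T e disc] in blast)
qed

section \<open>Integers coprime to a modulus\<close>

definition coprimes_below :: "nat \<Rightarrow> nat \<Rightarrow> nat" where
  "coprimes_below w k = card {m. m < k \<and> coprime m w}"

text \<open>The range of \<open>r\<close> makes \<open>coprimes_below w k\<close> the number of coprime \<open>m \<le> r\<close>
  (\<open>r < k\<close>) or of coprime \<open>m < r\<close> (\<open>k - 1 < r\<close>).\<close>
definition wheel :: "nat \<Rightarrow> real \<Rightarrow> real \<Rightarrow> bool" where
  "wheel w \<alpha> \<delta> \<longleftrightarrow> (\<forall>k r. r \<ge> 0 \<longrightarrow> real k - 1 \<le> r \<longrightarrow> r \<le> real k \<longrightarrow>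
     \<bar>real (coprimes_below w k) - \<alpha> * r\<bar> \<le> \<delta>)"

lemma coprimes_below_0 [simp]: "coprimes_below w 0 = 0"
  by (simp add: coprimes_below_def)

lemma coprimes_below_Suc [simp]:
  "coprimes_below w (Suc k) = (if coprime k w then Suc (coprimes_below w k) else coprimes_below w k)"
proof -
  have "{m. m < Suc k \<and> coprime m w} =
    (if coprime k w then insert k {m. m < k \<and> coprime m w} else {m. m < k \<and> coprime m w})"
    by (auto simp: less_Suc_eq)
  then show ?thesis by (simp add: coprimes_below_def)
qed

lemma coprimes_below_period:
  "coprimes_below w (w * q + j) = q * coprimes_below w w + coprimes_below w j"
proof -
  have cop: "coprime (w * q + j) w \<longleftrightarrow> coprime j w" for q j
    by (metis coprime_commute coprime_iff_gcd_eq_1 gcd_add_mult mult.commute add.commute gcd.commute)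
  have shift: "coprimes_below w (w * q + j) = coprimes_below w (w * q) + coprimes_below w j" for q j
    by (induction j) (use cop in auto)
  show ?thesis
  proof (induction q)
    case (Suc q)
    have "coprimes_below w (w * Suc q + j) = coprimes_below w (w * Suc q) + coprimes_below w j"
      by (rule shift)
    also have "coprimes_below w (w * Suc q) = coprimes_below w (w * q) + coprimes_below w w"
      using shift[of q w] by (simp add: add.commute)
    finally show ?case using Suc shift[of q j] by simp
  qed simp
qed

lemma wheelI:
  assumes w: "w > 0" and \<alpha>: "\<alpha> * real w = real (coprimes_below w w)"
    and res: "\<And>j. j < w \<Longrightarrow> \<bar>real (coprimes_below w j) - \<alpha> * real j\<bar> \<le> \<delta>
       \<and> (j > 0 \<longrightarrow> \<bar>real (coprimes_below w j) - \<alpha> * (real j - 1)\<bar> \<le> \<delta>)"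
    and neg: "\<alpha> \<le> \<delta>"
  shows "wheel w \<alpha> \<delta>"
  unfolding wheel_def
proof (intro allI impI)
  fix k :: nat and r :: real
  assume r: "r \<ge> 0" "real k - 1 \<le> r" "r \<le> real k"
  define q j where "q = k div w" and "j = k mod w"
  have k: "k = w * q + j" by (simp add: q_def j_def)
  have j: "j < w" using w by (simp add: j_def)
  have C: "real (coprimes_below w k) - \<alpha> * r = real (coprimes_below w j) - \<alpha> * (r - real w * real q)"
    unfolding k coprimes_below_period using \<alpha> by (simp add: algebra_simps flip: \<alpha>)
  have \<alpha>0: "\<alpha> \<ge> 0" using \<alpha> w by (smt (verit) mult_neg_pos of_nat_0_le_iff of_nat_0_less_iff)
  define s where "s = r - real w * real q"
  have s: "real j - 1 \<le> s" "s \<le> real j" using r by (auto simp: s_def k)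
  have up: "\<alpha> * s \<le> \<alpha> * real j" and lo: "\<alpha> * (real j - 1) \<le> \<alpha> * s"
    using s \<alpha>0 by (intro mult_left_mono; simp)+
  show "\<bar>real (coprimes_below w k) - \<alpha> * r\<bar> \<le> \<delta>"
  proof (cases "j = 0")
    case True
    then show ?thesis unfolding C s_def[symmetric] using up lo neg by (auto simp: abs_le_iff)
  next
    case False
    then show ?thesis unfolding C s_def[symmetric] using up lo res[OF j] by (auto simp: abs_le_iff)
  qed
qed

lemma wheel_2: "wheel 2 (1/2) (1/2)"
proof (rule wheelI)
  show "1/2 * real 2 = real (coprimes_below 2 2)" by (simp add: eval_nat_numeral)
  fix j :: nat assume "j < 2"
  then have "j \<in> {0,1}" by auto
  then show "\<bar>real (coprimes_below 2 j) - 1/2 * real j\<bar> \<le> 1/2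
       \<and> (j > 0 \<longrightarrow> \<bar>real (coprimes_below 2 j) - 1/2 * (real j - 1)\<bar> \<le> 1/2)"
    by (auto simp: eval_nat_numeral)
qed auto

lemma coprimes_below_code [code]:
  "coprimes_below w k = length (filter (\<lambda>m. gcd m w = 1) [0..<k])"
  by (induction k) (auto simp: coprime_iff_gcd_eq_1)

lemma coprimes_below_30:
  "map (coprimes_below 30) [0,1,2,3,4,5,6,7,8,9,10,11,12,13,14,15,16,17,18,19,20,21,22,23,24,25,26,27,28,29,30] =
    [0,0,1,1,1,1,1,1,2,2,2,2,3,3,4,4,4,4,5,5,6,6,6,6,7,7,7,7,7,7,8]"
  by code_simp

lemma wheel_30: "wheel 30 (4/15) (14/15)"
proof (rule wheelI)
  note C = coprimes_below_30[simplified list.map list.inject, simplified]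
  have C1: "coprimes_below 30 (Suc 0) = 0" using coprimes_below_30 by (simp only: list.map list.inject One_nat_def)
  show "4/15 * real 30 = real (coprimes_below 30 30)" using C by simp
  fix j :: nat assume "j < 30"
  then have "j \<in> {0,1,2,3,4,5,6,7,8,9,10,11,12,13,14,15,16,17,18,19,20,21,22,23,24,25,26,27,28,29}"
    by (simp; presburger)
  then show "\<bar>real (coprimes_below 30 j) - 4/15 * real j\<bar> \<le> 14/15
       \<and> (j > 0 \<longrightarrow> \<bar>real (coprimes_below 30 j) - 4/15 * (real j - 1)\<bar> \<le> 14/15)"
    by (elim insertE) (simp_all add: C C1 del: coprimes_below_Suc)
qed auto

lemma wheel_count_multiples:
  fixes a t :: real
  assumes a: "a \<ge> 0" "a \<le> t" and d: "d > 0" "coprime d w"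
  shows "card {n. coprime n w \<and> d dvd n \<and> a \<le> real n \<and> real n \<le> t}
      + coprimes_below w (nat \<lceil>a / real d\<rceil>) = coprimes_below w (Suc (nat \<lfloor>t / real d\<rfloor>))"
proof -
  let ?M = "{m. coprime m w \<and> a / real d \<le> real m \<and> real m \<le> t / real d}"
  let ?B = "{m. m < nat \<lceil>a / real d\<rceil> \<and> coprime m w}"
  have q: "0 \<le> a / real d" "a / real d \<le> t / real d"
    using a d by (auto intro: divide_right_mono)
  have lt: "m < nat \<lceil>a / real d\<rceil> \<longleftrightarrow> real m < a / real d" for m
    by linarith
  have le: "m < Suc (nat \<lfloor>t / real d\<rfloor>) \<longleftrightarrow> real m \<le> t / real d" for m
    using q by linarith
  have finM: "finite ?M"
    by (rule finite_subset[of _ "{..nat \<lfloor>t / real d\<rfloor>}"]) (auto simp: le_nat_floor)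
  have "{n. coprime n w \<and> d dvd n \<and> a \<le> real n \<and> real n \<le> t} = (*) d ` ?M"
  proof (intro equalityI subsetI)
    fix n assume n: "n \<in> {n. coprime n w \<and> d dvd n \<and> a \<le> real n \<and> real n \<le> t}"
    then obtain m where m: "n = d * m" by auto
    have "coprime m w" using n unfolding m by simp
    with n d have "m \<in> ?M" unfolding m by (simp add: divide_le_eq le_divide_eq mult.commute)
    with m show "n \<in> (*) d ` ?M" by blast
  next
    fix n assume "n \<in> (*) d ` ?M"
    then obtain m where "n = d * m" "m \<in> ?M" by blast
    with d show "n \<in> {n. coprime n w \<and> d dvd n \<and> a \<le> real n \<and> real n \<le> t}"
      by (simp add: divide_le_eq le_divide_eq mult.commute)
  qed
  then have "card {n. coprime n w \<and> d dvd n \<and> a \<le> real n \<and> real n \<le> t} = card ?M"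
    using d by (simp add: card_image inj_on_def)
  moreover have "card ?M + card ?B = card (?M \<union> ?B)"
  proof (rule card_Un_disjoint[symmetric])
    show "?M \<inter> ?B = {}" unfolding lt by fastforce
  qed (use finM in simp_all)
  moreover have "?M \<union> ?B = {m. m < Suc (nat \<lfloor>t / real d\<rfloor>) \<and> coprime m w}"
  proof (intro set_eqI)
    fix m
    have "real m \<le> t / real d" if "real m < a / real d" using that q by linarith
    then show "m \<in> ?M \<union> ?B \<longleftrightarrow> m \<in> {m. m < Suc (nat \<lfloor>t / real d\<rfloor>) \<and> coprime m w}"
      unfolding Un_iff mem_Collect_eq lt le by linarith
  qed
  ultimately show ?thesis unfolding coprimes_below_def by simp
qed

lemma finite_nat_real_interval: "finite {n::nat. P n \<and> a \<le> real n \<and> real n \<le> b}"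
proof (rule finite_subset)
  show "{n. P n \<and> a \<le> real n \<and> real n \<le> b} \<subseteq> {..nat \<lfloor>b\<rfloor>}" by (auto simp: le_nat_floor)
qed simp

lemma wheel_multiples_discrepancy:
  assumes wh: "wheel w \<alpha> \<delta>" and a: "a \<ge> 0" and d: "d > 0" "coprime d w"
  defines "e \<equiv> real (coprimes_below w (nat \<lceil>a / real d\<rceil>))"
  shows "\<bar>e - \<alpha> / real d * a\<bar> \<le> \<delta>"
    and "a \<le> t \<Longrightarrow> \<bar>real (card {n. coprime n w \<and> d dvd n \<and> a \<le> real n \<and> real n \<le> t}) + e - \<alpha> / real d * t\<bar> \<le> \<delta>"
proof -
  have qa: "0 \<le> a / real d" using a by simp
  have "\<bar>real (coprimes_below w (nat \<lceil>a / real d\<rceil>)) - \<alpha> * (a / real d)\<bar> \<le> \<delta>"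
    by (rule wh[unfolded wheel_def, rule_format]) (use qa in linarith)+
  then show "\<bar>e - \<alpha> / real d * a\<bar> \<le> \<delta>"
    unfolding e_def by simp
  assume t: "a \<le> t"
  have qt: "0 \<le> t / real d" using a t by simp
  have "\<bar>real (coprimes_below w (Suc (nat \<lfloor>t / real d\<rfloor>))) - \<alpha> * (t / real d)\<bar> \<le> \<delta>"
    by (rule wh[unfolded wheel_def, rule_format]) (use qt in linarith)+
  moreover have "real (card {n. coprime n w \<and> d dvd n \<and> a \<le> real n \<and> real n \<le> t}) + e =
      real (coprimes_below w (Suc (nat \<lfloor>t / real d\<rfloor>)))"
    unfolding e_def of_nat_add[symmetric] wheel_count_multiples[OF a t d] ..
  ultimately show "\<bar>real (card {n. coprime n w \<and> d dvd n \<and> a \<le> real n \<and> real n \<le> t}) + e - \<alpha> / real d * t\<bar> \<le> \<delta>"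
    by simp
qed

lemma W11_sum_multiples:
  assumes wh: "wheel w \<alpha> \<delta>" and a: "a \<ge> 0" and ab: "a < b" and W: "W11 {a..b} f h"
    and d: "d > 0" "coprime d w"
  shows "\<bar>(\<Sum>n\<in>{n. coprime n w \<and> d dvd n \<and> a \<le> real n \<and> real n \<le> b}. f (real n))
      - \<alpha> / real d * integral {a..b} f\<bar> \<le> \<delta> * (\<bar>f a\<bar> + \<bar>f b\<bar> + L1norm {a..b} h)"
proof (rule W11_discrepancy_bound[OF ab W _ _ wheel_multiples_discrepancy(1)[OF wh a d]])
  let ?T = "{n. coprime n w \<and> d dvd n \<and> a \<le> real n \<and> real n \<le> b}"
  show "finite ?T" using finite_nat_real_interval[of "\<lambda>n. coprime n w \<and> d dvd n" a b] by simp
  show "real ` ?T \<subseteq> {a..b}" by auto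
  fix t assume t: "t \<in> {a..b}"
  then have "{n \<in> ?T. real n \<le> t} = {n. coprime n w \<and> d dvd n \<and> a \<le> real n \<and> real n \<le> t}" by auto
  then show "\<bar>real (card {n \<in> ?T. real n \<le> t}) + real (coprimes_below w (nat \<lceil>a / real d\<rceil>)) - \<alpha> / real d * t\<bar> \<le> \<delta>"
    using wheel_multiples_discrepancy(2)[OF wh a d, of t] t by simp
qed

lemma wheel_harmonic_sum:
  assumes wh: "wheel w \<alpha> \<delta>" and a: "a > 0" and ab: "a \<le> b"
    and start: "real (coprimes_below w (nat \<lceil>a\<rceil>)) - \<alpha> * a = - \<delta>"
  shows "(\<Sum>n\<in>{n. coprime n w \<and> a \<le> real n \<and> real n \<le> b}. 1 / real n) \<ge> \<alpha> * ln (b / a)"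
proof -
  let ?T = "{n. coprime n w \<and> a \<le> real n \<and> real n \<le> b}"
  let ?e = "real (coprimes_below w (nat \<lceil>a\<rceil>))"
  let ?M = "\<lambda>t. real (card {n \<in> ?T. real n \<le> t}) + ?e - \<alpha> * t"
  define D where "D = (\<lambda>t::real. - (1 / t\<^sup>2))"
  have pos: "t > 0" if "t \<in> {a..b}" for t using that a by auto
  have C1: "C1_with_deriv {a..b} (\<lambda>t. 1 / t) D"
    unfolding C1_with_deriv_def D_def
  proof (intro conjI ballI)
    fix t assume "t \<in> {a..b}"
    then show "((\<lambda>t. 1 / t) has_real_derivative - (1 / t\<^sup>2)) (at t within {a..b})"
      using pos[of t] by (auto intro!: derivative_eq_intros simp: power2_eq_square)
  qed (use pos in \<open>fastforce intro!: continuous_intros\<close>)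
  have disc: "\<bar>?M t\<bar> \<le> \<delta>" if t: "t \<in> {a..b}" for t
  proof -
    have "{n \<in> ?T. real n \<le> t} = {n. coprime n w \<and> 1 dvd n \<and> a \<le> real n \<and> real n \<le> t}"
      using t by auto
    then show ?thesis
      using wheel_multiples_discrepancy(2)[OF wh less_imp_le[OF a], of 1 t] t by simp
  qed
  have Tb: "{n \<in> ?T. real n \<le> b} = ?T" by auto
  have iln: "((\<lambda>t. 1 / t) has_integral ln b - ln a) {a..b}"
  proof (rule fundamental_theorem_of_calculus[OF ab])
    fix t assume "t \<in> {a..b}"
    then show "(ln has_vector_derivative 1 / t) (at t within {a..b})"
      using pos[of t] unfolding has_real_derivative_iff_has_vector_derivative[symmetric]
      by (auto intro!: derivative_eq_intros)
  qed
  have iD: "((\<lambda>t. \<delta> * (1 / t\<^sup>2)) has_integral \<delta> * (1 / a - 1 / b)) {a..b}"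
  proof -
    have "((\<lambda>t. 1 / t\<^sup>2) has_integral (- (1 / b)) - (- (1 / a))) {a..b}"
    proof (rule fundamental_theorem_of_calculus[OF ab])
      fix t assume "t \<in> {a..b}"
      then show "((\<lambda>t. - (1 / t)) has_vector_derivative 1 / t\<^sup>2) (at t within {a..b})"
        using pos[of t] unfolding has_real_derivative_iff_has_vector_derivative[symmetric]
        by (auto intro!: derivative_eq_intros simp: power2_eq_square)
    qed
    from has_integral_mult_right[OF this, of \<delta>] show ?thesis by simp
  qed
  have \<delta>: "\<delta> \<ge> 0" using disc[of a] ab by auto
  have "integral {a..b} (\<lambda>t. D t * ?M t) \<le> \<delta> * (1 / a - 1 / b)"
  proof (cases "(\<lambda>t. D t * ?M t) integrable_on {a..b}")
    case True
    have "integral {a..b} (\<lambda>t. D t * ?M t) \<le> integral {a..b} (\<lambda>t. \<delta> * (1 / t\<^sup>2))"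
    proof (rule integral_le[OF True])
      show "(\<lambda>t. \<delta> * (1 / t\<^sup>2)) integrable_on {a..b}" using iD by blast
      fix t assume t: "t \<in> {a..b}"
      have "(1 / t\<^sup>2) * (- ?M t) \<le> (1 / t\<^sup>2) * \<delta>"
        using disc[OF t] by (intro mult_left_mono) auto
      then show "D t * ?M t \<le> \<delta> * (1 / t\<^sup>2)"
        by (simp only: D_def mult_minus_left mult_minus_right mult.commute[of \<delta>])
    qed
    then show ?thesis using iD by (simp add: integral_unique)
  next
    case False
    have "1 / b \<le> 1 / a" using a ab by (simp add: frac_le)
    then show ?thesis using False \<delta> by (simp add: not_integrable_integral)
  qed
  moreover have "finite ?T" using finite_nat_real_interval[of "\<lambda>n. coprime n w" a b] by simp
  then have "(\<Sum>n\<in>?T. 1 / real n) - \<alpha> * integral {a..b} (\<lambda>t. 1 / t) =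
      1 / b * (real (card ?T) + ?e - \<alpha> * b) - 1 / a * (?e - \<alpha> * a) - integral {a..b} (\<lambda>t. D t * ?M t)"
    by (intro C1_abel_summation[OF ab C1]) auto
  moreover have "1 / b * (real (card ?T) + ?e - \<alpha> * b) \<ge> 1 / b * (- \<delta>)"
    using disc[of b] ab a unfolding Tb by (intro mult_left_mono) auto
  ultimately have "(\<Sum>n\<in>?T. 1 / real n) \<ge> \<alpha> * (ln b - ln a)"
    using iln start by (simp add: integral_unique algebra_simps)
  then show ?thesis using a ab by (simp add: ln_div)
qed

section \<open>Selberg's weights\<close>

lemma prod_1_plus:
  fixes u :: "'a \<Rightarrow> 'b :: comm_semiring_1"
  assumes "finite A"
  shows "(\<Prod>x\<in>A. 1 + u x) = (\<Sum>B\<in>Pow A. \<Prod>x\<in>B. u x)"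
  by (simp add: prod_add[OF assms, of u "\<lambda>_. 1"] add.commute[of 1])

lemma sum_alternating_interval:
  assumes fin: "finite B"
  shows "(\<Sum>A | D \<subseteq> A \<and> A \<subseteq> B. (-1 :: real) ^ card A) = (if D = B then (-1) ^ card D else 0)"
proof (cases "D \<subseteq> B")
  case True
  have finD: "finite D" using True fin by (rule finite_subset)
  have "{A. D \<subseteq> A \<and> A \<subseteq> B} = (\<lambda>A. D \<union> A) ` Pow (B - D)"
  proof (intro equalityI subsetI)
    fix A assume "A \<in> {A. D \<subseteq> A \<and> A \<subseteq> B}"
    then show "A \<in> (\<lambda>A. D \<union> A) ` Pow (B - D)" by (intro image_eqI[of _ _ "A - D"]) auto
  qed (use True in auto)
  then have "(\<Sum>A | D \<subseteq> A \<and> A \<subseteq> B. (-1 :: real) ^ card A) =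
      (\<Sum>A\<in>Pow (B - D). (-1) ^ card (D \<union> A))"
    by (intro sum.reindex_cong[of "\<lambda>A. D \<union> A"]) (auto simp: inj_on_def)
  also have "\<dots> = (\<Sum>A\<in>Pow (B - D). (-1) ^ card D * (\<Prod>x\<in>A. -1))"
  proof (rule sum.cong[OF refl])
    fix A assume A: "A \<in> Pow (B - D)"
    then have "card (D \<union> A) = card D + card A"
      using fin finD by (intro card_Un_disjoint) (auto intro: finite_subset)
    then show "(-1 :: real) ^ card (D \<union> A) = (-1) ^ card D * (\<Prod>x\<in>A. -1)"
      by (simp add: power_add)
  qed
  also have "\<dots> = (-1) ^ card D * (\<Prod>x\<in>B - D. 1 + (-1))"
    using fin by (subst prod_1_plus) (auto simp: sum_distrib_left)
  also have "\<dots> = (if D = B then (-1) ^ card D else 0)"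
    using True fin by (auto simp: power_0_left card_eq_0_iff)
  finally show ?thesis .
next
  case False
  then have "{A. D \<subseteq> A \<and> A \<subseteq> B} = {}" by blast
  with False show ?thesis by (simp only: sum.empty) auto
qed

locale selberg_sieve =
  fixes F :: "nat set set"
  assumes finite_F: "finite F"
    and empty_F: "{} \<in> F"
    and subset_F: "A \<in> F \<Longrightarrow> B \<subseteq> A \<Longrightarrow> B \<in> F"
    and finite_elem: "A \<in> F \<Longrightarrow> finite A"
    and prime_elem: "A \<in> F \<Longrightarrow> p \<in> A \<Longrightarrow> prime p"
begin

definition g :: "nat set \<Rightarrow> real" where
  "g A = (\<Prod>p\<in>A. 1 / (real p - 1))"

definition L :: real where
  "L = (\<Sum>A\<in>F. g A)"

text \<open>Selberg's optimal weights, a squarefree \<open>d\<close> being encoded by its set of prime factors.\<close>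
definition lam :: "nat set \<Rightarrow> real" where
  "lam A = (-1) ^ card A * real (\<Prod>A) / L * (\<Sum>B | B \<in> F \<and> A \<subseteq> B. g B)"

lemma elem_gt_1: "A \<in> F \<Longrightarrow> p \<in> A \<Longrightarrow> real p > 1"
  using prime_elem[of A p] prime_gt_1_nat[of p] by simp

lemma g_pos: "A \<in> F \<Longrightarrow> g A > 0"
  unfolding g_def by (rule prod_pos) (use elem_gt_1 in auto)

lemma prod_pos_F: "A \<in> F \<Longrightarrow> real (\<Prod>A) > 0"
  using prime_elem[of A] prime_gt_0_nat by (auto intro!: prod_pos simp del: of_nat_prod)

lemma L_pos: "L > 0"
  unfolding L_def using finite_F empty_F g_pos by (intro sum_pos) auto

lemma lam_empty: "lam {} = 1"
  using L_pos by (simp add: lam_def L_def)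

lemma sum_lam_over_prod:
  assumes D: "D \<in> F"
  shows "(\<Sum>A | A \<in> F \<and> D \<subseteq> A. lam A / real (\<Prod>A)) = (-1) ^ card D * g D / L"
proof -
  have "(\<Sum>A | A \<in> F \<and> D \<subseteq> A. lam A / real (\<Prod>A)) =
      (\<Sum>A | A \<in> F \<and> D \<subseteq> A. \<Sum>B | B \<in> F \<and> A \<subseteq> B. (-1) ^ card A * g B / L)"
  proof (rule sum.cong[OF refl])
    fix A assume "A \<in> {A. A \<in> F \<and> D \<subseteq> A}"
    then have "real (\<Prod>A) > 0" using prod_pos_F by blast
    then have "lam A / real (\<Prod>A) = (-1) ^ card A / L * (\<Sum>B | B \<in> F \<and> A \<subseteq> B. g B)"
      unfolding lam_def by (simp del: of_nat_prod)
    then show "lam A / real (\<Prod>A) = (\<Sum>B | B \<in> F \<and> A \<subseteq> B. (-1) ^ card A * g B / L)"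
      by (simp add: sum_distrib_left)
  qed
  also have "\<dots> = (\<Sum>B\<in>F. \<Sum>A | A \<in> {A. A \<in> F \<and> D \<subseteq> A} \<and> A \<subseteq> B. (-1) ^ card A * g B / L)"
    using sum.swap_restrict[of "{A. A \<in> F \<and> D \<subseteq> A}" F "\<lambda>A B. (-1) ^ card A * g B / L" "\<lambda>A B. A \<subseteq> B"]
      finite_F by auto
  also have "\<dots> = (\<Sum>B\<in>F. g B / L * (if D = B then (-1) ^ card D else 0))"
  proof (rule sum.cong[OF refl])
    fix B assume B: "B \<in> F"
    have "{A. A \<in> {A. A \<in> F \<and> D \<subseteq> A} \<and> A \<subseteq> B} = {A. D \<subseteq> A \<and> A \<subseteq> B}"
      using B subset_F by blast
    then show "(\<Sum>A | A \<in> {A. A \<in> F \<and> D \<subseteq> A} \<and> A \<subseteq> B. (-1) ^ card A * g B / L) =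
        g B / L * (if D = B then (-1) ^ card D else 0)"
      unfolding sum_alternating_interval[OF finite_elem[OF B], of D, symmetric]
      by (simp add: sum_distrib_left mult.commute)
  qed
  also have "\<dots> = (-1) ^ card D * g D / L"
    using finite_F D by (simp add: if_distrib[of "\<lambda>x. _ * x"] mult.commute cong: if_cong)
  finally show ?thesis .
qed

lemma inverse_prod_union:
  assumes A: "A \<in> F" and B: "B \<in> F"
  shows "1 / real (\<Prod>(A \<union> B)) =
    (\<Sum>D | D \<in> F \<and> D \<subseteq> A \<and> D \<subseteq> B. 1 / g D) / (real (\<Prod>A) * real (\<Prod>B))"
proof -
  have AB: "A \<inter> B \<in> F" using A by (rule subset_F) auto
  have "\<Prod>(A \<union> B) * \<Prod>(A \<inter> B) = \<Prod>A * \<Prod>B"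
    using finite_elem[OF A] finite_elem[OF B] by (rule prod.union_inter)
  then have "real (\<Prod>(A \<union> B)) * real (\<Prod>(A \<inter> B)) = real (\<Prod>A) * real (\<Prod>B)"
    by (simp only: of_nat_mult[symmetric])
  moreover have "1 / real (\<Prod>(A \<union> B)) =
      real (\<Prod>(A \<inter> B)) / (real (\<Prod>(A \<union> B)) * real (\<Prod>(A \<inter> B)))"
    using prod_pos_F[OF AB] by (simp del: of_nat_prod)
  ultimately have *: "1 / real (\<Prod>(A \<union> B)) = real (\<Prod>(A \<inter> B)) / (real (\<Prod>A) * real (\<Prod>B))"
    by simp
  have "real (\<Prod>(A \<inter> B)) = (\<Prod>p\<in>A \<inter> B. 1 + (real p - 1))" by simp
  also have "\<dots> = (\<Sum>D\<in>Pow (A \<inter> B). \<Prod>p\<in>D. real p - 1)"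
    by (rule prod_1_plus) (use finite_elem[OF AB] in simp)
  also have "Pow (A \<inter> B) = {D. D \<in> F \<and> D \<subseteq> A \<and> D \<subseteq> B}"
    using subset_F[OF A] by auto
  also have "(\<Sum>D\<in>{D. D \<in> F \<and> D \<subseteq> A \<and> D \<subseteq> B}. \<Prod>p\<in>D. real p - 1) =
      (\<Sum>D | D \<in> F \<and> D \<subseteq> A \<and> D \<subseteq> B. 1 / g D)"
    by (simp add: g_def prod_dividef)
  finally show ?thesis using * by simp
qed

lemma quadratic_form:
  "(\<Sum>A\<in>F. \<Sum>B\<in>F. lam A * lam B / real (\<Prod>(A \<union> B))) = 1 / L"
proof -
  let ?x = "\<lambda>A. lam A / real (\<Prod>A)"
  have "(\<Sum>A\<in>F. \<Sum>B\<in>F. lam A * lam B / real (\<Prod>(A \<union> B))) =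
      (\<Sum>A\<in>F. \<Sum>B\<in>F. \<Sum>D\<in>F. if D \<subseteq> A \<and> D \<subseteq> B then ?x A * ?x B / g D else 0)"
  proof (intro sum.cong refl)
    fix A B assume AB: "A \<in> F" "B \<in> F"
    have "lam A * lam B / real (\<Prod>(A \<union> B)) = lam A * lam B * (1 / real (\<Prod>(A \<union> B)))"
      by simp
    also have "\<dots> = (\<Sum>D | D \<in> F \<and> D \<subseteq> A \<and> D \<subseteq> B. ?x A * ?x B / g D)"
      unfolding inverse_prod_union[OF AB] by (simp add: sum_distrib_left sum_divide_distrib field_simps del: of_nat_prod)
    also have "\<dots> = (\<Sum>D\<in>F. if D \<subseteq> A \<and> D \<subseteq> B then ?x A * ?x B / g D else 0)"
      using finite_F by (simp only: sum.inter_filter)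
    finally show "lam A * lam B / real (\<Prod>(A \<union> B)) =
      (\<Sum>D\<in>F. if D \<subseteq> A \<and> D \<subseteq> B then ?x A * ?x B / g D else 0)" .
  qed
  also have "\<dots> = (\<Sum>A\<in>F. \<Sum>D\<in>F. \<Sum>B\<in>F. if D \<subseteq> A \<and> D \<subseteq> B then ?x A * ?x B / g D else 0)"
    by (intro sum.cong refl sum.swap)
  also have "\<dots> = (\<Sum>D\<in>F. \<Sum>A\<in>F. \<Sum>B\<in>F. if D \<subseteq> A \<and> D \<subseteq> B then ?x A * ?x B / g D else 0)"
    by (rule sum.swap)
  also have "\<dots> = (\<Sum>D\<in>F. g D / L\<^sup>2)"
  proof (rule sum.cong[OF refl])
    fix D assume D: "D \<in> F"
    let ?y = "\<lambda>A. if D \<subseteq> A then ?x A else 0"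
    have "(\<Sum>A\<in>F. \<Sum>B\<in>F. if D \<subseteq> A \<and> D \<subseteq> B then ?x A * ?x B / g D else 0) =
        (\<Sum>A\<in>F. \<Sum>B\<in>F. ?y A * ?y B / g D)"
      by (intro sum.cong refl) auto
    also have "\<dots> = (\<Sum>A\<in>F. ?y A) * (\<Sum>B\<in>F. ?y B) / g D"
      by (simp only: sum_product sum_divide_distrib)
    also have "(\<Sum>A\<in>F. ?y A) = (-1) ^ card D * g D / L"
      using sum_lam_over_prod[OF D] finite_F by (simp only: sum.inter_filter)
    also have "((-1) ^ card D * g D / L) * ((-1) ^ card D * g D / L) / g D = g D / L\<^sup>2"
      using g_pos[OF D] L_pos by (simp add: field_simps power2_eq_square flip: power_mult_distrib)
    finally show "(\<Sum>A\<in>F. \<Sum>B\<in>F. if D \<subseteq> A \<and> D \<subseteq> B then ?x A * ?x B / g D else 0) = g D / L\<^sup>2" .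
  qed
  also have "\<dots> = 1 / L"
    using L_pos by (simp add: L_def[symmetric] power2_eq_square flip: sum_divide_distrib)
  finally show ?thesis .
qed

lemma sum_abs_lam:
  "(\<Sum>A\<in>F. \<bar>lam A\<bar>) = (\<Sum>B\<in>F. \<Prod>p\<in>B. 1 + 2 / (real p - 1)) / L"
proof -
  have "\<bar>lam A\<bar> = (\<Sum>B | B \<in> F \<and> A \<subseteq> B. real (\<Prod>A) * g B / L)" if "A \<in> F" for A
  proof -
    have "(\<Sum>B | B \<in> F \<and> A \<subseteq> B. g B) \<ge> 0"
      by (rule sum_nonneg) (use g_pos in \<open>auto intro: less_imp_le\<close>)
    then have "\<bar>lam A\<bar> = real (\<Prod>A) / L * (\<Sum>B | B \<in> F \<and> A \<subseteq> B. g B)"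
      using L_pos prod_pos_F[OF that] by (simp add: lam_def abs_mult power_abs del: of_nat_prod)
    then show ?thesis by (simp add: sum_distrib_left del: of_nat_prod)
  qed
  then have "(\<Sum>A\<in>F. \<bar>lam A\<bar>) = (\<Sum>A\<in>F. \<Sum>B | B \<in> F \<and> A \<subseteq> B. real (\<Prod>A) * g B / L)"
    by simp
  also have "\<dots> = (\<Sum>B\<in>F. \<Sum>A | A \<in> F \<and> A \<subseteq> B. real (\<Prod>A) * g B / L)"
    by (rule sum.swap_restrict[OF finite_F finite_F])
  also have "\<dots> = (\<Sum>B\<in>F. (\<Prod>p\<in>B. 1 + 2 / (real p - 1)) / L)"
  proof (rule sum.cong[OF refl])
    fix B assume B: "B \<in> F"
    have eq: "{A. A \<in> F \<and> A \<subseteq> B} = Pow B" using subset_F[OF B] by auto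
    have "(\<Sum>A | A \<in> F \<and> A \<subseteq> B. real (\<Prod>A) * g B / L) = (\<Sum>A\<in>Pow B. \<Prod>p\<in>A. real p) * g B / L"
      unfolding eq by (simp add: sum_distrib_right sum_divide_distrib)
    also have "(\<Sum>A\<in>Pow B. \<Prod>p\<in>A. real p) = (\<Prod>p\<in>B. 1 + real p)"
      using finite_elem[OF B] by (rule prod_1_plus[symmetric])
    also have "\<dots> * g B = (\<Prod>p\<in>B. 1 + 2 / (real p - 1))"
      unfolding g_def prod.distrib[symmetric]
    proof (rule prod.cong[OF refl])
      fix p assume "p \<in> B"
      then have "real p - 1 \<noteq> 0" using elem_gt_1[OF B] by fastforce
      then show "(1 + real p) * (1 / (real p - 1)) = 1 + 2 / (real p - 1)"
        by (simp add: divide_simps)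
    qed
    finally show "(\<Sum>A | A \<in> F \<and> A \<subseteq> B. real (\<Prod>A) * g B / L) = (\<Prod>p\<in>B. 1 + 2 / (real p - 1)) / L" .
  qed
  finally show ?thesis by (simp add: sum_divide_distrib)
qed

lemma prod_dvd_iff:
  assumes A: "A \<in> F" and B: "B \<in> F"
  shows "\<Prod>(A \<union> B) dvd n \<longleftrightarrow> \<Prod>A dvd n \<and> \<Prod>B dvd n"
proof
  have fin: "finite (A \<union> B)" using finite_elem A B by auto
  show "\<Prod>(A \<union> B) dvd n \<Longrightarrow> \<Prod>A dvd n \<and> \<Prod>B dvd n"
    using prod_dvd_prod_subset[OF fin, of A id] prod_dvd_prod_subset[OF fin, of B id]
    by (auto intro: dvd_trans)
  assume "\<Prod>A dvd n \<and> \<Prod>B dvd n"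
  then have dvd: "p dvd n" if "p \<in> A \<union> B" for p
    using that dvd_prodI[of A p id] dvd_prodI[of B p id] finite_elem[OF A] finite_elem[OF B]
    by (auto intro: dvd_trans)
  have "C \<subseteq> A \<union> B \<Longrightarrow> \<Prod>C dvd n" if "finite C" for C
    using that
  proof (induction C rule: finite_induct)
    case (insert p C)
    have pr: "prime q" if "q \<in> insert p C" for q
      using that insert.prems prime_elem[OF A] prime_elem[OF B] by auto
    have "coprime p (\<Prod>C)"
      using insert.hyps pr by (intro prod_coprime_right) (auto intro!: primes_coprime)
    then show ?case using insert dvd[of p] by (simp add: divides_mult)
  qed simp
  then show "\<Prod>(A \<union> B) dvd n" using fin by blast
qed

end

context selberg_sieve
begin

lemma lam_sum_prime:
  assumes p: "prime p" and nF: "{p} \<notin> F"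
  shows "(\<Sum>A | A \<in> F \<and> \<Prod>A dvd p. lam A) = 1"
proof -
  have "A = {}" if A: "A \<in> F" "\<Prod>A dvd p" for A
  proof (rule ccontr)
    assume "A \<noteq> {}"
    then obtain q where q: "q \<in> A" by blast
    then have "q dvd \<Prod>A" using finite_elem[OF A(1)] dvd_prodI[of A q id] by simp
    then have "q dvd p" using A(2) dvd_trans by blast
    with prime_elem[OF A(1) q] p have "q = p" by (simp add: primes_dvd_imp_eq)
    with q subset_F[OF A(1), of "{p}"] nF show False by auto
  qed
  then have "{A. A \<in> F \<and> \<Prod>A dvd p} = {{}}" using empty_F by auto
  then show ?thesis by (simp only: sum.insert) (simp add: lam_empty)
qed

lemma weighted_sum_le:
  assumes wh: "wheel w \<alpha> \<delta>" and a: "a \<ge> 0" and ab: "a < b" and W: "W11 {a..b} f h"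
    and cop: "\<And>A p. A \<in> F \<Longrightarrow> p \<in> A \<Longrightarrow> coprime p w"
  shows "(\<Sum>n | coprime n w \<and> a \<le> real n \<and> real n \<le> b.
       f (real n) * (\<Sum>A | A \<in> F \<and> \<Prod>A dvd n. lam A)\<^sup>2)
    \<le> \<alpha> * integral {a..b} f / L
      + \<delta> * (\<bar>f a\<bar> + \<bar>f b\<bar> + L1norm {a..b} h) * (\<Sum>A\<in>F. \<bar>lam A\<bar>)\<^sup>2"
proof -
  let ?T = "{n. coprime n w \<and> a \<le> real n \<and> real n \<le> b}"
  let ?V = "\<bar>f a\<bar> + \<bar>f b\<bar> + L1norm {a..b} h"
  let ?S = "\<lambda>A B. \<Sum>n | n \<in> ?T \<and> \<Prod>(A \<union> B) dvd n. f (real n)"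
  have finT: "finite ?T" using finite_nat_real_interval[of "\<lambda>n. coprime n w" a b] by simp
  have S: "\<bar>?S A B - \<alpha> / real (\<Prod>(A \<union> B)) * integral {a..b} f\<bar> \<le> \<delta> * ?V"
    if AB: "A \<in> F" "B \<in> F" for A B
  proof -
    have "0 < real (\<Prod>(A \<union> B))"
      using prime_elem[OF AB(1)] prime_elem[OF AB(2)] prime_gt_0_nat by (auto intro!: prod_pos simp: prod_pos)
    then have pos: "\<Prod>(A \<union> B) > 0" by (simp only: of_nat_0_less_iff)
    have co: "coprime (\<Prod>(A \<union> B)) w"
      using cop[OF AB(1)] cop[OF AB(2)] by (intro prod_coprime_left) auto
    have "{n. n \<in> ?T \<and> \<Prod>(A \<union> B) dvd n} = {n. coprime n w \<and> \<Prod>(A \<union> B) dvd n \<and> a \<le> real n \<and> real n \<le> b}"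
      by auto
    then show ?thesis using W11_sum_multiples[OF wh a ab W pos co] by (simp del: of_nat_prod)
  qed
  have "(\<Sum>n\<in>?T. f (real n) * (\<Sum>A | A \<in> F \<and> \<Prod>A dvd n. lam A)\<^sup>2) =
      (\<Sum>n\<in>?T. \<Sum>A\<in>F. \<Sum>B\<in>F. if \<Prod>(A \<union> B) dvd n then lam A * lam B * f (real n) else 0)"
  proof (rule sum.cong[OF refl])
    fix n
    let ?y = "\<lambda>A. if \<Prod>A dvd n then lam A else 0"
    have "(\<Sum>A | A \<in> F \<and> \<Prod>A dvd n. lam A) = (\<Sum>A\<in>F. ?y A)"
      using finite_F by (simp only: sum.inter_filter)
    then have "f (real n) * (\<Sum>A | A \<in> F \<and> \<Prod>A dvd n. lam A)\<^sup>2 =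
        f (real n) * (\<Sum>A\<in>F. \<Sum>B\<in>F. ?y A * ?y B)"
      by (simp only: power2_eq_square sum_product)
    also have "\<dots> = (\<Sum>A\<in>F. \<Sum>B\<in>F. f (real n) * (?y A * ?y B))"
      by (simp only: sum_distrib_left)
    also have "\<dots> = (\<Sum>A\<in>F. \<Sum>B\<in>F. if \<Prod>(A \<union> B) dvd n then lam A * lam B * f (real n) else 0)"
      by (intro sum.cong refl) (auto simp: prod_dvd_iff)
    finally show "f (real n) * (\<Sum>A | A \<in> F \<and> \<Prod>A dvd n. lam A)\<^sup>2 =
      (\<Sum>A\<in>F. \<Sum>B\<in>F. if \<Prod>(A \<union> B) dvd n then lam A * lam B * f (real n) else 0)" .
  qed
  also have "\<dots> = (\<Sum>A\<in>F. \<Sum>n\<in>?T. \<Sum>B\<in>F. if \<Prod>(A \<union> B) dvd n then lam A * lam B * f (real n) else 0)"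
    by (rule sum.swap)
  also have "\<dots> = (\<Sum>A\<in>F. \<Sum>B\<in>F. \<Sum>n\<in>?T. if \<Prod>(A \<union> B) dvd n then lam A * lam B * f (real n) else 0)"
    by (intro sum.cong refl sum.swap)
  also have "\<dots> = (\<Sum>A\<in>F. \<Sum>B\<in>F. lam A * lam B * ?S A B)"
    using finT by (simp only: sum.inter_filter[symmetric] sum_distrib_left)
  also have "\<dots> \<le> (\<Sum>A\<in>F. \<Sum>B\<in>F. \<alpha> * integral {a..b} f * (lam A * lam B / real (\<Prod>(A \<union> B)))
      + \<delta> * ?V * (\<bar>lam A\<bar> * \<bar>lam B\<bar>))"
  proof (intro sum_mono)
    fix A B assume AB: "A \<in> F" "B \<in> F"
    define X where "X = ?S A B - \<alpha> / real (\<Prod>(A \<union> B)) * integral {a..b} f"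
    have "lam A * lam B * X \<le> \<bar>lam A * lam B * X\<bar>" by (rule abs_ge_self)
    also have "\<dots> \<le> \<bar>lam A\<bar> * \<bar>lam B\<bar> * (\<delta> * ?V)"
      unfolding abs_mult using S[OF AB] unfolding X_def by (intro mult_left_mono) simp_all
    finally have "lam A * lam B * X \<le> \<bar>lam A\<bar> * \<bar>lam B\<bar> * (\<delta> * ?V)" .
    moreover have "lam A * lam B * ?S A B =
        \<alpha> * integral {a..b} f * (lam A * lam B / real (\<Prod>(A \<union> B))) + lam A * lam B * X"
      unfolding X_def by (simp add: right_diff_distrib del: of_nat_prod)
    ultimately show "lam A * lam B * ?S A B \<le> \<alpha> * integral {a..b} f * (lam A * lam B / real (\<Prod>(A \<union> B)))
      + \<delta> * ?V * (\<bar>lam A\<bar> * \<bar>lam B\<bar>)"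
      by (simp only: mult.commute[of "\<delta> * ?V"])
  qed
  also have "\<dots> = \<alpha> * integral {a..b} f * (\<Sum>A\<in>F. \<Sum>B\<in>F. lam A * lam B / real (\<Prod>(A \<union> B)))
      + \<delta> * ?V * (\<Sum>A\<in>F. \<Sum>B\<in>F. \<bar>lam A\<bar> * \<bar>lam B\<bar>)"
    by (simp only: sum.distrib sum_distrib_left)
  also have "\<dots> = \<alpha> * integral {a..b} f / L + \<delta> * ?V * (\<Sum>A\<in>F. \<bar>lam A\<bar>)\<^sup>2"
    unfolding quadratic_form by (simp add: power2_eq_square sum_product)
  finally show ?thesis .
qed

end

section \<open>The sifting sets\<close>

definition rough_sets :: "real \<Rightarrow> nat set set" where
  "rough_sets R = {A. finite A \<and> (\<forall>p\<in>A. prime p \<and> 7 \<le> p) \<and> real (\<Prod>A) \<le> R}"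

lemma elem_le_prod:
  assumes "finite A" "\<forall>p\<in>A. prime p" "p \<in> A"
  shows "p \<le> (\<Prod>A :: nat)"
proof (rule dvd_imp_le)
  show "p dvd \<Prod>A" using assms dvd_prodI[of A p id] by simp
  show "0 < \<Prod>A" using assms(2) prime_gt_0_nat by (auto intro!: prod_pos simp del: of_nat_prod)
qed

lemma selberg_sieve_rough_sets:
  assumes R: "R \<ge> 1"
  shows "selberg_sieve (rough_sets R)"
proof
  show "finite (rough_sets R)"
  proof (rule finite_subset)
    show "rough_sets R \<subseteq> Pow {..nat \<lfloor>R\<rfloor>}"
    proof safe
      fix A p assume A: "A \<in> rough_sets R" "p \<in> A"
      then have "real p \<le> real (\<Prod>A)"
        using elem_le_prod[of A p] by (auto simp: rough_sets_def simp del: of_nat_prod)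
      also have "\<dots> \<le> R" using A by (auto simp: rough_sets_def)
      finally show "p \<le> nat \<lfloor>R\<rfloor>" by (simp add: le_nat_floor)
    qed
  qed simp
  show "{} \<in> rough_sets R" using R by (simp add: rough_sets_def)
  fix A B assume A: "A \<in> rough_sets R"
  show "finite A" using A by (simp add: rough_sets_def)
  show "prime p" if "p \<in> A" for p using A that by (simp add: rough_sets_def)
  assume B: "B \<subseteq> A"
  have "\<Prod>B dvd \<Prod>A" using A B by (intro prod_dvd_prod_subset) (auto simp: rough_sets_def)
  moreover have "\<Prod>A > 0" using A prime_gt_0_nat by (auto intro!: prod_pos simp: rough_sets_def)
  ultimately have "real (\<Prod>B) \<le> real (\<Prod>A)" using dvd_imp_le by (simp del: of_nat_prod)
  also have "\<dots> \<le> R" using A by (simp add: rough_sets_def)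
  finally show "B \<in> rough_sets R"
    using A B by (auto simp: rough_sets_def intro: finite_subset simp del: of_nat_prod)
qed

lemma prime_less_7:
  fixes p :: nat
  assumes p: "prime p" and less: "p < 7"
  shows "p \<in> {2,3,5}"
proof -
  have "p \<in> {0,1,2,3,4,5,6}" using less by (simp; presburger)
  moreover have "\<not> prime (4::nat)" "\<not> prime (6::nat)"
    using prime_nat_not_dvd[of 4 2] prime_nat_not_dvd[of 6 2] by auto
  ultimately show ?thesis using p by auto
qed

lemma coprime_30_iff:
  fixes p :: nat
  assumes p: "prime p"
  shows "coprime p 30 \<longleftrightarrow> 7 \<le> p"
proof
  assume co: "coprime p 30"
  show "7 \<le> p"
  proof (rule ccontr)
    assume "\<not> 7 \<le> p"
    then have "p \<in> {2,3,5}" using prime_less_7[OF p] by simp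
    then have "p dvd 30" by auto
    then have "is_unit p" by (rule coprime_common_divisor[OF co dvd_refl])
    with p show False by simp
  qed
next
  assume p7: "7 \<le> p"
  have "\<not> p dvd 30"
  proof
    assume "p dvd 30"
    then have "p dvd 5 * 6" by simp
    then have "p dvd 5 \<or> p dvd 6" by (rule prime_dvd_multD[OF p])
    then show False using p7 dvd_imp_le[of p 5] dvd_imp_le[of p 6] by auto
  qed
  with p show "coprime p 30" by (rule prime_imp_coprime)
qed

lemma rough_prod_coprime: "A \<in> rough_sets R \<Longrightarrow> coprime (\<Prod>A) 30"
  by (intro prod_coprime_left) (auto simp: rough_sets_def coprime_30_iff)

lemma inj_on_prod_primes: "inj_on (\<lambda>A. \<Prod>A) {A :: nat set. finite A \<and> (\<forall>p\<in>A. prime p)}"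
proof (rule inj_on_inverseI)
  fix A :: "nat set" assume A: "A \<in> {A. finite A \<and> (\<forall>p\<in>A. prime p)}"
  have "q \<in> A" if "prime q" "q dvd \<Prod>A" for q
  proof -
    have "\<exists>p\<in>A. q dvd p" using A that prime_dvd_prod_iff[of A q id] by simp
    then obtain p where "p \<in> A" "q dvd p" by blast
    then show ?thesis using A that by (auto dest: primes_dvd_imp_eq)
  qed
  then show "{p. prime p \<and> p dvd \<Prod>A} = A"
    using A by (auto intro: dvd_prodI[of A _ id, simplified])
qed

lemma coprimes_below_30_le:
  assumes k: "k \<ge> 12"
  shows "real (coprimes_below 30 k) \<le> 6 / 19 * (real k - 1)"
proof (cases "k \<ge> 20")
  case True
  have "\<bar>real (coprimes_below 30 k) - 4 / 15 * (real k - 1)\<bar> \<le> 14 / 15"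
    by (rule wheel_30[unfolded wheel_def, rule_format]) (use k in auto)
  then have "real (coprimes_below 30 k) \<le> 4 / 15 * (real k - 1) + 14 / 15"
    by (simp only: abs_le_iff diff_le_eq add.commute)
  also have "\<dots> \<le> 6 / 19 * (real k - 1)"
  proof -
    have "real k \<ge> 20" using True by simp
    then show ?thesis by (simp add: field_simps)
  qed
  finally show ?thesis .
next
  case False
  note C = coprimes_below_30[simplified list.map list.inject, simplified]
  have "k \<in> {12,13,14,15,16,17,18,19}" using k False by auto
  then show ?thesis by (elim insertE) (simp_all add: C del: coprimes_below_Suc)
qed

lemma card_rough_sets:
  assumes R: "R \<ge> 11"
  shows "real (card (rough_sets R)) \<le> 6 / 19 * R"
proof -
  let ?k = "Suc (nat \<lfloor>R\<rfloor>)"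
  have "card (rough_sets R) \<le> card {m. m < ?k \<and> coprime m 30}"
  proof (rule card_inj_on_le)
    show "inj_on (\<lambda>A. \<Prod>A) (rough_sets R)"
      by (rule inj_on_subset[OF inj_on_prod_primes]) (auto simp: rough_sets_def)
    show "(\<lambda>A. \<Prod>A) ` rough_sets R \<subseteq> {m. m < ?k \<and> coprime m 30}"
    proof (rule image_subsetI)
      fix A assume A: "A \<in> rough_sets R"
      then have "real (\<Prod>A) \<le> R" by (simp add: rough_sets_def)
      then have "\<Prod>A \<le> nat \<lfloor>R\<rfloor>" by (simp only: le_nat_floor)
      then show "\<Prod>A \<in> {m. m < ?k \<and> coprime m 30}" using rough_prod_coprime[OF A] by simp
    qed
  qed simp
  moreover have "real (coprimes_below 30 ?k) \<le> 6 / 19 * (real ?k - 1)"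
    by (rule coprimes_below_30_le) (use R in linarith)
  moreover have "6 / 19 * (real ?k - 1) \<le> 6 / 19 * R" using R by simp
  ultimately show ?thesis unfolding coprimes_below_def by (meson of_nat_mono order_trans)
qed

text \<open>The bound telescopes because
  \<open>1 + 2 / (m (m - 1)) \<le> v m / v (m + 2)\<close> for \<open>v m = (m - 1) / (m - 2)\<close>.\<close>
lemma prod_primes_ge_11:
  "(\<Prod>p | prime p \<and> 11 \<le> p \<and> p \<le> 2 * k + 9. 1 + 2 / (real p * (real p - 1)))
    \<le> 10 / 9 * ((2 * real k + 9) / (2 * real k + 10))"
proof (induction k)
  case 0
  have "{p::nat. prime p \<and> 11 \<le> p \<and> p \<le> 2 * 0 + 9} = {}" by auto
  then show ?case by (simp only: prod.empty) simp
next
  case (Suc k)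
  let ?P = "\<lambda>k. {p::nat. prime p \<and> 11 \<le> p \<and> p \<le> 2 * k + 9}"
  let ?u = "\<lambda>p. 1 + 2 / (real p * (real p - 1))"
  let ?m = "2 * k + 11"
  have fin: "finite (?P k)" by (rule finite_subset[of _ "{..2 * k + 9}"]) auto
  have nonneg: "(\<Prod>p\<in>?P k. ?u p) \<ge> 0" by (intro prod_nonneg) auto
  have "\<not> prime (2 * k + 10)"
    using prime_nat_not_dvd[of "2 * k + 10" 2] by auto
  then have sub: "?P (Suc k) = (if prime ?m then insert ?m (?P k) else ?P k)"
  proof -
    have "p \<le> 2 * Suc k + 9 \<longleftrightarrow> p \<le> 2 * k + 9 \<or> p = 2 * k + 10 \<or> p = ?m" for p by auto
    with \<open>\<not> prime (2 * k + 10)\<close> show ?thesis by auto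
  qed
  have "(\<Prod>p\<in>?P (Suc k). ?u p) \<le> ?u ?m * (\<Prod>p\<in>?P k. ?u p)"
  proof (cases "prime ?m")
    case True
    then show ?thesis unfolding sub using fin by simp
  next
    case False
    have "1 * (\<Prod>p\<in>?P k. ?u p) \<le> ?u ?m * (\<Prod>p\<in>?P k. ?u p)"
      by (rule mult_right_mono[OF _ nonneg]) simp
    then show ?thesis unfolding sub using False by simp
  qed
  also have "\<dots> \<le> ?u ?m * (10 / 9 * ((2 * real k + 9) / (2 * real k + 10)))"
    by (rule mult_left_mono[OF Suc]) simp
  also have "\<dots> \<le> 10 / 9 * ((2 * real (Suc k) + 9) / (2 * real (Suc k) + 10))"
  proof -
    have move: "c \<le> x / y" if "c * (y / x) \<le> 1" "x > 0" "y > 0" for c x y :: real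
      using that by (simp add: field_simps)
    define q where "q = real ?m * (real ?m - 1)"
    have q: "q > 0" by (simp add: q_def)
    have "(1 + 2 / q) * ((q - 2) * (1 / q)) \<le> 1"
      using q by (simp add: field_simps)
    moreover have "(q - 2) * (1 / q) =
        ((2 * real k + 9) / (2 * real k + 10)) * ((2 * real k + 12) / (2 * real k + 11))"
      by (simp add: q_def divide_simps) (simp add: algebra_simps)
    ultimately have "?u ?m * ((2 * real k + 9) / (2 * real k + 10)) * ((2 * real k + 12) / (2 * real k + 11)) \<le> 1"
      by (simp only: q_def mult.assoc)
    then have "?u ?m * ((2 * real k + 9) / (2 * real k + 10)) \<le> (2 * real k + 11) / (2 * real k + 12)"
      by (rule move) simp_all
    then have "10 / 9 * (?u ?m * ((2 * real k + 9) / (2 * real k + 10)))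
        \<le> 10 / 9 * ((2 * real k + 11) / (2 * real k + 12))"
      by (rule mult_left_mono) simp
    then show ?thesis by (simp only: mult.left_commute[of "10 / 9"]) (simp add: algebra_simps)
  qed
  finally show ?case .
qed

lemma prod_primes_ge_7:
  assumes fin: "finite Q" and Q: "\<forall>p\<in>Q. prime p \<and> 7 \<le> p"
  shows "(\<Prod>p\<in>Q. 1 + 2 / (real p * (real p - 1))) \<le> 220 / 189"
proof -
  let ?u = "\<lambda>p. 1 + 2 / (real p * (real p - 1))"
  define k where "k = Max (insert 0 Q)"
  have k: "p \<le> k" if "p \<in> Q" for p using fin that by (auto simp: k_def)
  let ?P = "{p::nat. prime p \<and> 11 \<le> p \<and> p \<le> 2 * k + 9}"
  have finP: "finite ?P" by (rule finite_subset[of _ "{..2 * k + 9}"]) auto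
  have "Q \<subseteq> insert 7 ?P"
  proof
    fix p assume p: "p \<in> Q"
    then have pr: "prime p" "7 \<le> p" "p \<le> 2 * k + 9" using Q k[OF p] by auto
    have "p \<noteq> 8" "p \<noteq> 9" "p \<noteq> 10"
      using pr(1) prime_nat_not_dvd[of 8 2] prime_nat_not_dvd[of 9 3] prime_nat_not_dvd[of 10 2] by auto
    then show "p \<in> insert 7 ?P" using pr by auto
  qed
  then have "(\<Prod>p\<in>Q. ?u p) \<le> (\<Prod>p\<in>insert 7 ?P. ?u p)"
    using finP by (intro prod_mono2) auto
  also have "\<dots> = 22 / 21 * (\<Prod>p\<in>?P. ?u p)" using finP by simp
  also have "\<dots> \<le> 22 / 21 * (10 / 9 * ((2 * real k + 9) / (2 * real k + 10)))"
    by (intro mult_left_mono prod_primes_ge_11) simp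
  also have "\<dots> \<le> 220 / 189" by (simp add: divide_simps)
  finally show ?thesis .
qed

lemma sum_prod_le_rough_sets:
  assumes R: "R \<ge> 11"
  shows "(\<Sum>B\<in>rough_sets R. \<Prod>p\<in>B. 1 + 2 / (real p - 1)) \<le> 12 / 25 * R"
proof -
  let ?F = "rough_sets R"
  interpret S: selberg_sieve ?F using R by (intro selberg_sieve_rough_sets) simp
  define h where "h A = (\<Prod>p\<in>A. 2 / (real p - 1))" for A :: "nat set"
  define k where "k A = (\<Prod>p\<in>A. 2 / (real p * (real p - 1)))" for A :: "nat set"
  have h_nonneg: "h A \<ge> 0" if "A \<in> ?F" for A
    unfolding h_def by (rule prod_nonneg) (use S.elem_gt_1[OF that] in fastforce)
  have hk: "k A = h A / real (\<Prod>A)" for A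
    unfolding h_def k_def of_nat_prod prod_dividef[symmetric] by (simp add: mult.commute)
  have "(\<Sum>B\<in>?F. \<Prod>p\<in>B. 1 + 2 / (real p - 1)) = (\<Sum>B\<in>?F. \<Sum>A | A \<in> ?F \<and> A \<subseteq> B. h A)"
  proof (rule sum.cong[OF refl])
    fix B assume B: "B \<in> ?F"
    have "Pow B = {A. A \<in> ?F \<and> A \<subseteq> B}" using S.subset_F[OF B] by auto
    then show "(\<Prod>p\<in>B. 1 + 2 / (real p - 1)) = (\<Sum>A | A \<in> ?F \<and> A \<subseteq> B. h A)"
      unfolding h_def prod_1_plus[OF S.finite_elem[OF B]] by simp
  qed
  also have "\<dots> = (\<Sum>A\<in>?F. \<Sum>B | B \<in> ?F \<and> A \<subseteq> B. h A)"
    by (rule sum.swap_restrict[OF S.finite_F S.finite_F])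
  also have "\<dots> = (\<Sum>A\<in>?F. h A * real (card {B. B \<in> ?F \<and> A \<subseteq> B}))"
    by (simp add: mult.commute)
  also have "\<dots> = h {} * real (card {B. B \<in> ?F \<and> {} \<subseteq> B})
      + (\<Sum>A\<in>?F - {{}}. h A * real (card {B. B \<in> ?F \<and> A \<subseteq> B}))"
    by (rule sum.remove[OF S.finite_F S.empty_F])
  also have "h {} * real (card {B. B \<in> ?F \<and> {} \<subseteq> B}) \<le> 6 / 19 * R"
    using card_rough_sets[OF R] by (simp add: h_def)
  also have "(\<Sum>A\<in>?F - {{}}. h A * real (card {B. B \<in> ?F \<and> A \<subseteq> B})) \<le> (\<Sum>A\<in>?F - {{}}. R * k A)"
  proof (rule sum_mono)
    fix A assume "A \<in> ?F - {{}}"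
    then have A: "A \<in> ?F" by simp
    have pos: "real (\<Prod>A) > 0" by (rule S.prod_pos_F[OF A])
    have split: "\<Prod>B = \<Prod>A * \<Prod>(B - A)" if "B \<in> ?F" "A \<subseteq> B" for B
      using prod.subset_diff[OF that(2) S.finite_elem[OF that(1)], of id] by (simp add: mult.commute)
    have "card {B. B \<in> ?F \<and> A \<subseteq> B} \<le> card {1..nat \<lfloor>R / real (\<Prod>A)\<rfloor>}"
    proof (rule card_inj_on_le)
      show "inj_on (\<lambda>B. \<Prod>(B - A)) {B. B \<in> ?F \<and> A \<subseteq> B}"
      proof (rule inj_onI)
        fix B C assume BC: "B \<in> {B. B \<in> ?F \<and> A \<subseteq> B}" "C \<in> {B. B \<in> ?F \<and> A \<subseteq> B}"
          and "\<Prod>(B - A) = \<Prod>(C - A)"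
        then have "\<Prod>B = \<Prod>C" using split by simp
        then show "B = C"
          using BC by (intro inj_onD[OF inj_on_prod_primes]) (simp_all add: rough_sets_def)
      qed
      show "(\<lambda>B. \<Prod>(B - A)) ` {B. B \<in> ?F \<and> A \<subseteq> B} \<subseteq> {1..nat \<lfloor>R / real (\<Prod>A)\<rfloor>}"
      proof (rule image_subsetI)
        fix B assume "B \<in> {B. B \<in> ?F \<and> A \<subseteq> B}"
        then have B: "B \<in> ?F" "A \<subseteq> B" by auto
        have BA: "B - A \<in> ?F" by (rule S.subset_F[OF B(1)]) auto
        have "real (\<Prod>(B - A)) > 0" by (rule S.prod_pos_F[OF BA])
        then have "\<Prod>(B - A) \<ge> 1" by (simp only: of_nat_0_less_iff)
        moreover have "real (\<Prod>A) * real (\<Prod>(B - A)) \<le> R"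
          using B(1) unfolding of_nat_mult[symmetric] split[OF B, symmetric]
          by (simp add: rough_sets_def)
        then have "real (\<Prod>(B - A)) \<le> R / real (\<Prod>A)"
          using pos by (simp only: pos_le_divide_eq mult.commute)
        then have "\<Prod>(B - A) \<le> nat \<lfloor>R / real (\<Prod>A)\<rfloor>" by (rule le_nat_floor)
        ultimately show "\<Prod>(B - A) \<in> {1..nat \<lfloor>R / real (\<Prod>A)\<rfloor>}" by simp
      qed
    qed simp
    then have "real (card {B. B \<in> ?F \<and> A \<subseteq> B}) \<le> real (nat \<lfloor>R / real (\<Prod>A)\<rfloor>)"
      by (simp only: of_nat_le_iff card_atLeastAtMost diff_Suc_1)
    also have "\<dots> \<le> R / real (\<Prod>A)" using R pos by (intro of_nat_floor divide_nonneg_pos) auto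
    finally have "h A * real (card {B. B \<in> ?F \<and> A \<subseteq> B}) \<le> h A * (R / real (\<Prod>A))"
      by (rule mult_left_mono) (rule h_nonneg[OF A])
    then show "h A * real (card {B. B \<in> ?F \<and> A \<subseteq> B}) \<le> R * k A"
      unfolding hk by (simp add: mult.commute del: of_nat_prod)
  qed
  also have "(\<Sum>A\<in>?F - {{}}. R * k A) = R * (\<Sum>A\<in>?F - {{}}. k A)"
    by (simp only: sum_distrib_left)
  also have "(\<Sum>A\<in>?F - {{}}. k A) \<le> 31 / 189"
  proof -
    have fin: "finite (\<Union>?F)" using S.finite_F S.finite_elem by auto
    have Q: "\<forall>p\<in>\<Union>?F. prime p \<and> 7 \<le> p" by (auto simp: rough_sets_def)
    have "k {} + (\<Sum>A\<in>?F - {{}}. k A) = (\<Sum>A\<in>?F. k A)"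
      by (rule sum.remove[OF S.finite_F S.empty_F, symmetric])
    also have "\<dots> \<le> (\<Sum>A\<in>Pow (\<Union>?F). k A)"
    proof (rule sum_mono2)
      fix A assume "A \<in> Pow (\<Union>?F) - ?F"
      then have "\<forall>p\<in>A. 7 \<le> p" using Q by blast
      then show "0 \<le> k A" unfolding k_def by (intro prod_nonneg) force
    qed (use fin in auto)
    also have "\<dots> = (\<Prod>p\<in>\<Union>?F. 1 + 2 / (real p * (real p - 1)))"
      unfolding k_def by (rule prod_1_plus[OF fin, symmetric])
    also have "\<dots> \<le> 220 / 189" by (rule prod_primes_ge_7[OF fin Q])
    finally show ?thesis by (simp add: k_def)
  qed
  finally show ?thesis using R by (simp add: field_simps)
qed

lemma sum_inverse_powers:
  assumes "p > (1::real)"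
  shows "(\<Sum>j=1..N. (1 / p) ^ j) = (1 - (1 / p) ^ N) / (p - 1)"
proof (induction N)
  case (Suc N)
  have "(1 - x) / (p - 1) + 1 / p * x = (1 - 1 / p * x) / (p - 1)" for x
    using assms by (simp add: field_simps)
  from this[of "(1 / p) ^ N"] Suc show ?case by simp
qed simp

lemma sum_inverse_same_radical:
  assumes fin: "finite T" and T: "\<And>n. n \<in> T \<Longrightarrow> n > 0 \<and> prime_factors n = A"
    and A: "finite A" "\<forall>p\<in>A. prime p"
  shows "(\<Sum>n\<in>T. 1 / real n) \<le> (\<Prod>p\<in>A. 1 / (real p - 1))"
proof -
  define N where "N = Max (insert 0 T)"
  have N: "n \<le> N" if "n \<in> T" for n using fin that by (simp add: N_def)
  define \<phi> :: "(nat \<Rightarrow> nat) \<Rightarrow> nat" where "\<phi> e = (\<Prod>p\<in>A. p ^ e p)" for e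
  let ?E = "PiE A (\<lambda>_. {1..N})"
  have finE: "finite ?E" using A by (intro finite_PiE) auto
  have gt1: "real p > 1" if "p \<in> A" for p using A that prime_gt_1_nat[of p] by auto
  have "T \<subseteq> \<phi> ` ?E"
  proof
    fix n assume n: "n \<in> T"
    then have n0: "n > 0" and pf: "prime_factors n = A" using T by auto
    have "(\<lambda>p\<in>A. multiplicity p n) \<in> ?E"
    proof (rule restrict_PiE_iff[THEN iffD2], rule ballI)
      fix p assume p: "p \<in> A"
      then have pr: "prime p" using A by auto
      have "multiplicity p n \<ge> 1"
        using p pf by (metis One_nat_def Suc_leI prime_factors_multiplicity mem_Collect_eq)
      moreover have "multiplicity p n < p ^ multiplicity p n"
        using pr prime_gt_1_nat by (intro power_gt_expt) auto
      moreover have "p ^ multiplicity p n \<le> n"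
        using n0 by (intro dvd_imp_le multiplicity_dvd) auto
      ultimately show "multiplicity p n \<in> {1..N}" using N[OF n] by simp
    qed
    moreover have "n = \<phi> (\<lambda>p\<in>A. multiplicity p n)"
      using prime_factorization_nat[OF n0] unfolding pf \<phi>_def by simp
    ultimately show "n \<in> \<phi> ` ?E" by blast
  qed
  then have "(\<Sum>n\<in>T. 1 / real n) \<le> (\<Sum>n\<in>\<phi> ` ?E. 1 / real n)"
    using finE by (intro sum_mono2) auto
  also have "\<dots> \<le> (\<Sum>e\<in>?E. 1 / real (\<phi> e))"
    using sum_image_le[OF finE, of "\<lambda>n. 1 / real n" \<phi>] by (simp add: o_def)
  also have "\<dots> = (\<Sum>e\<in>?E. \<Prod>p\<in>A. (1 / real p) ^ e p)"
    by (simp add: \<phi>_def prod_dividef power_divide)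
  also have "\<dots> = (\<Prod>p\<in>A. \<Sum>j=1..N. (1 / real p) ^ j)"
    using A by (intro prod_sum_PiE[symmetric]) auto
  also have "\<dots> \<le> (\<Prod>p\<in>A. 1 / (real p - 1))"
  proof (rule prod_mono)
    fix p assume p: "p \<in> A"
    have "(1 - (1 / real p) ^ N) / (real p - 1) \<le> 1 / (real p - 1)"
      using gt1[OF p] by (intro divide_right_mono) auto
    then have "(\<Sum>j=1..N. (1 / real p) ^ j) \<le> 1 / (real p - 1)"
      by (simp only: sum_inverse_powers[OF gt1[OF p]])
    then show "0 \<le> (\<Sum>j=1..N. (1 / real p) ^ j) \<and> (\<Sum>j=1..N. (1 / real p) ^ j) \<le> 1 / (real p - 1)"
      by (simp add: sum_nonneg)
  qed
  finally show ?thesis .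
qed

lemma L_rough_sets_ge:
  assumes R: "R \<ge> 11"
  shows "8 / 7 + 4 / 15 * ln (R / 11) \<le> selberg_sieve.L (rough_sets R)"
proof -
  let ?F = "rough_sets R"
  interpret S: selberg_sieve ?F using R by (intro selberg_sieve_rough_sets) simp
  let ?T = "{n. coprime n 30 \<and> 1 \<le> real n \<and> real n \<le> R}"
  let ?U = "{n. coprime n 30 \<and> 11 \<le> real n \<and> real n \<le> R}"
  have finT: "finite ?T" using finite_nat_real_interval[of "\<lambda>n. coprime n 30" 1 R] by simp
  have "4 / 15 * ln (R / 11) \<le> (\<Sum>n\<in>?U. 1 / real n)"
  proof (rule wheel_harmonic_sum[OF wheel_30])
    have "coprimes_below 30 11 = 2"
      using coprimes_below_30 by (simp only: list.map list.inject)
    then show "real (coprimes_below 30 (nat \<lceil>11 :: real\<rceil>)) - 4 / 15 * 11 = - (14 / 15)" by simp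
  qed (use R in auto)
  moreover have "(\<Sum>n\<in>{1,7} \<union> ?U. 1 / real n) \<le> (\<Sum>n\<in>?T. 1 / real n)"
  proof (rule sum_mono2[OF finT])
    have "coprime (7::nat) 30" by (rule coprime_30_iff[THEN iffD2]) simp_all
    then show "{1,7} \<union> ?U \<subseteq> ?T" using R by auto
  qed auto
  moreover have "(\<Sum>n\<in>{1,7} \<union> ?U. 1 / real n) = 8 / 7 + (\<Sum>n\<in>?U. 1 / real n)"
  proof -
    have "finite ?U" using finite_nat_real_interval[of "\<lambda>n. coprime n 30" 11 R] by simp
    moreover have "{1,7} \<inter> ?U = {}" by auto
    ultimately have "(\<Sum>n\<in>{1,7} \<union> ?U. 1 / real n) = (\<Sum>n\<in>{1,7::nat}. 1 / real n) + (\<Sum>n\<in>?U. 1 / real n)"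
      by (intro sum.union_disjoint) auto
    then show ?thesis by simp
  qed
  moreover have "(\<Sum>n\<in>?T. 1 / real n) \<le> S.L"
  proof -
    have "prime_factors ` ?T \<subseteq> ?F"
    proof (rule image_subsetI)
      fix n assume n: "n \<in> ?T"
      then have n0: "n > 0" by auto
      have "7 \<le> p" if "p \<in> prime_factors n" for p
      proof -
        have "p dvd n" "prime p" using that by auto
        moreover have "coprime n 30" using n by simp
        ultimately have "coprime p 30" by (metis coprime_divisors dvd_refl)
        then show ?thesis using coprime_30_iff[OF \<open>prime p\<close>] by simp
      qed
      moreover have "\<Prod>(prime_factors n) \<le> n"
      proof -
        have "\<Prod>(prime_factors n) dvd (\<Prod>p\<in>prime_factors n. p ^ multiplicity p n)"
          by (rule prod_dvd_prod) (auto simp: prime_factors_multiplicity intro!: dvd_power)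
        then show ?thesis using prime_factorization_nat[OF n0] n0 dvd_imp_le by metis
      qed
      then have "real (\<Prod>(prime_factors n)) \<le> real n" by (simp only: of_nat_le_iff)
      then have "real (\<Prod>(prime_factors n)) \<le> R" using n by (simp del: of_nat_prod)
      ultimately show "prime_factors n \<in> ?F"
        unfolding rough_sets_def by (simp del: of_nat_prod add: in_prime_factors_iff)
    qed
    then have "(\<Sum>n\<in>?T. 1 / real n) = (\<Sum>A\<in>?F. \<Sum>n | n \<in> ?T \<and> prime_factors n = A. 1 / real n)"
      by (intro sum.group[symmetric] finT S.finite_F)
    also have "\<dots> \<le> (\<Sum>A\<in>?F. S.g A)"
    proof (rule sum_mono)
      fix A assume A: "A \<in> ?F"
      show "(\<Sum>n | n \<in> ?T \<and> prime_factors n = A. 1 / real n) \<le> S.g A"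
        unfolding S.g_def
      proof (rule sum_inverse_same_radical)
        show "finite {n. n \<in> ?T \<and> prime_factors n = A}"
          by (rule finite_subset[OF _ finT]) auto
      qed (use A in \<open>auto simp: rough_sets_def\<close>)
    qed
    finally show ?thesis by (simp only: S.L_def)
  qed
  ultimately show ?thesis by linarith
qed

section \<open>Numerical inequalities\<close>

lemma ln_le_of_le_power_2:
  assumes "x > 0" "x \<le> 2 ^ n"
  shows "ln x \<le> 25 / 36 * real n"
proof -
  have "ln x \<le> ln (2 ^ n :: real)" using assms by simp
  also have "\<dots> = real n * ln 2" by (simp add: ln_realpow)
  also have "\<dots> \<le> real n * (25 / 36)" by (intro mult_left_mono ln2_le_25_over_36) simp
  finally show ?thesis by simp
qed

lemma small_rho_odd:
  fixes \<rho> :: real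
  assumes \<rho>: "1 < \<rho>" "\<rho> \<le> 30"
  shows "\<rho> / 2 + 2 < 2 * \<rho> / ln \<rho>"
proof -
  let ?f = "\<lambda>t::real. 4 - 16 / (t + 4) - ln t"
  have "?f 30 \<le> ?f \<rho>"
  proof (rule DERIV_nonpos_imp_nonincreasing[OF \<rho>(2)])
    fix t assume t: "\<rho> \<le> t" "t \<le> 30"
    then have t0: "t > 0" using \<rho> by simp
    have "(?f has_real_derivative 16 / (t + 4)\<^sup>2 - 1 / t) (at t)"
      using t0 by (auto intro!: derivative_eq_intros simp: power2_eq_square)
    moreover have "16 * t \<le> (t + 4)\<^sup>2"
      using zero_le_power2[of "t - 4"] by (simp add: power2_eq_square algebra_simps)
    then have "16 / (t + 4)\<^sup>2 - 1 / t \<le> 0"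
      using t0 by (simp add: divide_simps)
    ultimately show "\<exists>y. (?f has_real_derivative y) (at t) \<and> y \<le> 0" by blast
  qed
  moreover have "ln (30 :: real) \<le> 25 / 36 * real 5" by (rule ln_le_of_le_power_2) auto
  ultimately have "ln \<rho> < 4 - 16 / (\<rho> + 4)" by simp
  also have "\<dots> = 4 * \<rho> / (\<rho> + 4)" using \<rho> by (simp add: field_simps)
  finally have "ln \<rho> * (\<rho> + 4) < 4 * \<rho>" using \<rho> by (simp add: pos_less_divide_eq)
  moreover have "ln \<rho> > 0" using \<rho> by simp
  ultimately show ?thesis by (simp add: pos_less_divide_eq algebra_simps)
qed

lemma medium_rho_wheel_30:
  fixes \<rho> :: real
  assumes \<rho>: "30 \<le> \<rho>" "\<rho> \<le> 1024"
  shows "4 / 15 * \<rho> + 28 / 15 + 3 < 2 * \<rho> / ln \<rho>"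
proof -
  have step: ?thesis if "a \<le> \<rho>" "\<rho> \<le> 2 ^ n" "25 / 36 * real n * (4 * a + 73) < 30 * a" "n \<le> 10" for a n
  proof -
    have ln: "ln \<rho> \<le> 25 / 36 * real n" using that \<rho> by (intro ln_le_of_le_power_2) auto
    have "real n \<le> 10" using that(4) by simp
    then have "(30 - 4 * (25 / 36 * real n)) * a \<le> (30 - 4 * (25 / 36 * real n)) * \<rho>"
      using that by (intro mult_left_mono) auto
    then have "25 / 36 * real n * (4 * \<rho> + 73) < 30 * \<rho>"
      using that(3) by (simp add: algebra_simps)
    moreover have "ln \<rho> * (4 * \<rho> + 73) \<le> 25 / 36 * real n * (4 * \<rho> + 73)"
      using ln \<rho> by (intro mult_right_mono) auto
    ultimately have "ln \<rho> * (4 * \<rho> + 73) < 30 * \<rho>" by linarith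
    moreover have "ln \<rho> > 0" using \<rho> by simp
    ultimately show ?thesis by (simp add: pos_less_divide_eq algebra_simps)
  qed
  consider "\<rho> \<le> 64" | "64 \<le> \<rho>" "\<rho> \<le> 256" | "256 \<le> \<rho>" by linarith
  then show ?thesis
  proof cases
    case 1 then show ?thesis using step[of 30 6] \<rho> by simp
  next
    case 2 then show ?thesis using step[of 64 8] by simp
  next
    case 3 then show ?thesis using step[of 256 10] \<rho> by simp
  qed
qed

lemma exp_ge_quartic:
  assumes "(l::real) \<ge> 0"
  shows "1 + l + l\<^sup>2 / 2 + l ^ 3 / 6 + l ^ 4 / 24 \<le> exp l"
proof -
  have "(\<Sum>k<5. l ^ k /\<^sub>R fact k) \<le> (\<Sum>k. l ^ k /\<^sub>R fact k)"
    using assms by (intro sum_le_suminf summable_exp_generic) auto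
  then show ?thesis
    by (simp add: exp_def eval_nat_numeral field_simps)
qed

text \<open>The factor \<open>11 / 32\<close> makes \<open>R / 11 = exp l / 2 ^ 5\<close>, so that only an upper bound for
  \<open>ln 2\<close> is needed.\<close>
lemma large_rho_selberg:
  fixes l L R \<rho> :: real
  assumes \<rho>: "\<rho> \<ge> 1024" and l: "l = ln \<rho> / 2" and R: "R = 11 / 32 * exp l"
    and L: "L \<ge> 8 / 7 + 4 / 15 * ln (R / 11)"
  shows "3 + 6 / 19 * R + 4 / 15 * \<rho> / L + 28 / 15 * (12 / 25 * R / L)\<^sup>2 < 2 * \<rho> / ln \<rho>"
proof -
  define s where "s = exp l"
  define u :: real where "u = 4067 / 5000"
  have \<rho>s: "\<rho> = s\<^sup>2"
    using \<rho> by (simp add: s_def l power2_eq_square flip: exp_add)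
  have s32: "s \<ge> 32"
  proof (rule ccontr)
    assume "\<not> s \<ge> 32"
    then have "s * s < 32 * 32" by (intro mult_strict_mono') (auto simp: s_def)
    then show False using \<rho> \<rho>s by (simp add: power2_eq_square)
  qed
  have l_pos: "l > 0" using \<rho> by (simp add: l)
  have "ln (R / 11) = ln (s / 32)" by (simp add: R s_def)
  also have "\<dots> = l - ln 32" using s32 by (simp add: ln_div s_def)
  finally have "ln (R / 11) = l - ln 32" .
  moreover have "ln (32::real) \<le> 25 / 36 * real 5" by (rule ln_le_of_le_power_2) auto
  ultimately have "ln (R / 11) \<ge> l - 125 / 36" by simp
  then have L1: "L \<ge> 4 / 15 * (l + u)" using L by (simp add: u_def)
  define v where "v = l + u"
  have v_pos: "v > 0" using l_pos by (simp add: v_def u_def)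
  have L_pos: "L > 0" using L1 v_pos by (simp add: v_def)
  have t1: "4 / 15 * \<rho> / L \<le> s\<^sup>2 / v"
  proof -
    have "4 / 15 * \<rho> / L \<le> 4 / 15 * \<rho> / (4 / 15 * v)"
      using L1 v_pos \<rho> L_pos by (intro divide_left_mono) (auto simp: v_def)
    then show ?thesis by (simp add: \<rho>s)
  qed
  have t2: "28 / 15 * (12 / 25 * R / L)\<^sup>2 \<le> 143 / 200 * s\<^sup>2 / v\<^sup>2"
  proof -
    have "12 / 25 * R / L \<le> 12 / 25 * R / (4 / 15 * v)"
      using L1 v_pos L_pos by (intro divide_left_mono) (auto simp: v_def R)
    also have "\<dots> = 99 / 160 * s / v" using v_pos by (simp add: R s_def)
    finally have "(12 / 25 * R / L)\<^sup>2 \<le> (99 / 160 * s / v)\<^sup>2"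
      using L_pos by (intro power_mono) (auto simp: R)
    then have "28 / 15 * (12 / 25 * R / L)\<^sup>2 \<le> (28 / 15 * (99 / 160)\<^sup>2) * (s\<^sup>2 / v\<^sup>2)"
      by (simp add: power_divide power_mult_distrib)
    also have "\<dots> \<le> 143 / 200 * (s\<^sup>2 / v\<^sup>2)"
      by (intro mult_right_mono) (auto simp: power2_eq_square)
    finally show ?thesis by simp
  qed
  have t3: "3 + 6 / 19 * R \<le> 203 / 1000 * s"
    using s32 by (simp add: R s_def[symmetric])
  have key: "203 / 1000 * l * v\<^sup>2 < s * (u * v - 143 / 200 * l)"
  proof -
    let ?e = "1 + l + l\<^sup>2 / 2 + l ^ 3 / 6 + l ^ 4 / 24"
    have uv: "u * v - 143 / 200 * l = (u - 143 / 200) * l + u\<^sup>2"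
      by (simp add: v_def algebra_simps power2_eq_square)
    have "203 / 1000 * l * v\<^sup>2 < ?e * (49 / 500 * l + 661 / 1000)"
    proof -
      have "203 / 1000 * l * v\<^sup>2 \<le> 203 / 1000 * l * (l + 163 / 200)\<^sup>2"
        using l_pos by (intro mult_left_mono power_mono) (auto simp: v_def u_def)
      also have "\<dots> < ?e * (49 / 500 * l + 661 / 1000)"
      proof -
        have "?e * (49 / 500 * l + 661 / 1000) - 203 / 1000 * l * (l + 163 / 200)\<^sup>2 =
            49 / 12000 * l ^ 5 + l\<^sup>2 * (1053 / 24000 * (l - 1/2)\<^sup>2)
            + 1 / 24000 * l ^ 3 + 69313 / 800000 * l\<^sup>2 + 24966493 / 40000000 * l + 661 / 1000"
          by (simp add: field_simps power2_eq_square eval_nat_numeral)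
        also have "\<dots> > 0"
          using l_pos by (intro add_nonneg_pos add_nonneg_nonneg mult_nonneg_nonneg)
            (auto simp: power2_eq_square)
        finally show ?thesis by simp
      qed
      finally show ?thesis .
    qed
    also have "\<dots> \<le> s * (49 / 500 * l + 661 / 1000)"
      using exp_ge_quartic[of l] l_pos by (intro mult_right_mono) (auto simp: s_def)
    also have "\<dots> \<le> s * ((u - 143 / 200) * l + u\<^sup>2)"
      using s32 l_pos by (intro mult_left_mono add_mono mult_right_mono) (auto simp: u_def power2_eq_square)
    finally show ?thesis unfolding uv .
  qed
  have "203 / 1000 * s + s\<^sup>2 / v + 143 / 200 * s\<^sup>2 / v\<^sup>2 < s\<^sup>2 / l"
  proof -
    have "s * (203 / 1000 * l * v\<^sup>2) < s * (s * (u * v - 143 / 200 * l))"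
      using key s32 by (intro mult_strict_left_mono) auto
    then have "203 / 1000 * s * (l * v\<^sup>2) < s\<^sup>2 * (v - l) * v - 143 / 200 * s\<^sup>2 * l"
      by (simp add: v_def power2_eq_square algebra_simps)
    then have "(203 / 1000 * s * (l * v\<^sup>2)) / (l * v\<^sup>2) < (s\<^sup>2 * (v - l) * v - 143 / 200 * s\<^sup>2 * l) / (l * v\<^sup>2)"
      using l_pos v_pos by (intro divide_strict_right_mono) auto
    then have "203 / 1000 * s < (s\<^sup>2 * (v - l) * v - 143 / 200 * s\<^sup>2 * l) / (l * v\<^sup>2)"
      using l_pos v_pos by simp
    also have "\<dots> = s\<^sup>2 / l - s\<^sup>2 / v - 143 / 200 * s\<^sup>2 / v\<^sup>2"
      using l_pos v_pos by (simp add: field_simps power2_eq_square)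
    finally show ?thesis by linarith
  qed
  moreover have "2 * \<rho> / ln \<rho> = s\<^sup>2 / l" using l_pos by (simp add: l \<rho>s field_simps)
  ultimately show ?thesis using t1 t2 t3 by linarith
qed

section \<open>Sums over primes\<close>

lemma sum_primes_le_weighted:
  fixes f :: "real \<Rightarrow> real" and W :: "nat \<Rightarrow> real"
  assumes f: "\<And>t. t \<in> {a..b} \<Longrightarrow> 0 \<le> f t \<and> f t \<le> M" and W: "\<And>n. W n \<ge> 0"
    and M: "M \<ge> 0" and K: "finite K"
    and out: "\<And>p. prime p \<Longrightarrow> p \<notin> K \<Longrightarrow> coprime p w \<and> W p = 1"
  shows "(\<Sum>p | prime p \<and> real p \<in> {a..b}. f (real p))
    \<le> real (card K) * M + (\<Sum>n | coprime n w \<and> a \<le> real n \<and> real n \<le> b. f (real n) * W n)"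
proof -
  let ?P = "{p::nat. prime p \<and> real p \<in> {a..b}}"
  let ?T = "{n. coprime n w \<and> a \<le> real n \<and> real n \<le> b}"
  have finP: "finite ?P" using finite_nat_real_interval[of prime a b] by simp
  have finT: "finite ?T" using finite_nat_real_interval[of "\<lambda>n. coprime n w" a b] by simp
  have "(\<Sum>p\<in>?P. f (real p)) = (\<Sum>p\<in>?P \<inter> K. f (real p)) + (\<Sum>p\<in>?P - K. f (real p))"
    using finP by (rule sum.Int_Diff)
  also have "(\<Sum>p\<in>?P \<inter> K. f (real p)) \<le> real (card (?P \<inter> K)) * M"
    using f by (intro sum_bounded_above) auto
  also have "\<dots> \<le> real (card K) * M"
    using K M by (intro mult_right_mono) (auto intro: card_mono)
  also have "(\<Sum>p\<in>?P - K. f (real p)) = (\<Sum>p\<in>?P - K. f (real p) * W p)"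
    using out by (intro sum.cong) auto
  also have "\<dots> \<le> (\<Sum>n\<in>?T. f (real n) * W n)"
    using out f W by (intro sum_mono2 finT mult_nonneg_nonneg) auto
  finally show ?thesis by simp
qed

lemma sum_primes_le_wheel:
  assumes wh: "wheel w \<alpha> \<delta>" and a: "a \<ge> 0" and ab: "a < b" and W: "W11 {a..b} f h"
    and f: "\<And>t. t \<in> {a..b} \<Longrightarrow> 0 \<le> f t \<and> f t \<le> M" and M: "M \<ge> 0"
    and K: "finite K" "\<And>p. prime p \<Longrightarrow> p \<notin> K \<Longrightarrow> coprime p w"
  shows "(\<Sum>p | prime p \<and> real p \<in> {a..b}. f (real p))
    \<le> real (card K) * M + \<alpha> * integral {a..b} f + \<delta> * (\<bar>f a\<bar> + \<bar>f b\<bar> + L1norm {a..b} h)"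
proof -
  have "(\<Sum>p | prime p \<and> real p \<in> {a..b}. f (real p)) \<le> real (card K) * M +
      (\<Sum>n | coprime n w \<and> a \<le> real n \<and> real n \<le> b. f (real n) * 1)"
    by (rule sum_primes_le_weighted) (use f M K in auto)
  moreover have "\<bar>(\<Sum>n | coprime n w \<and> a \<le> real n \<and> real n \<le> b. f (real n))
      - \<alpha> * integral {a..b} f\<bar> \<le> \<delta> * (\<bar>f a\<bar> + \<bar>f b\<bar> + L1norm {a..b} h)"
    using W11_sum_multiples[OF wh a ab W, of 1] by simp
  ultimately show ?thesis by (simp add: abs_le_iff)
qed

lemma sum_primes_le_selberg:
  assumes R: "R \<ge> 11" and a: "a \<ge> 0" and ab: "a < b" and W: "W11 {a..b} f h"
    and f: "\<And>t. t \<in> {a..b} \<Longrightarrow> 0 \<le> f t \<and> f t \<le> M" and M: "M \<ge> 0"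
    and S: "(\<Sum>B\<in>rough_sets R. \<Prod>p\<in>B. 1 + 2 / (real p - 1)) \<le> S"
  defines "L \<equiv> selberg_sieve.L (rough_sets R)"
  shows "(\<Sum>p | prime p \<and> real p \<in> {a..b}. f (real p))
    \<le> (3 + 6 / 19 * R) * M + 4 / 15 * integral {a..b} f / L
      + 14 / 15 * (\<bar>f a\<bar> + \<bar>f b\<bar> + L1norm {a..b} h) * (S / L)\<^sup>2"
proof -
  let ?F = "rough_sets R"
  let ?V = "\<bar>f a\<bar> + \<bar>f b\<bar> + L1norm {a..b} h"
  interpret S: selberg_sieve ?F using R by (intro selberg_sieve_rough_sets) simp
  let ?W = "\<lambda>n. (\<Sum>A | A \<in> ?F \<and> \<Prod>A dvd n. S.lam A)\<^sup>2"
  let ?Q = "{p. {p} \<in> ?F}"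
  let ?K = "{2,3,5} \<union> ?Q"
  have img: "(\<lambda>p. {p}) ` ?Q \<subseteq> ?F" by auto
  have finQ: "finite ?Q" by (rule inj_on_finite[OF _ img S.finite_F]) simp
  have "card ?Q \<le> card ?F" by (rule card_inj_on_le[OF _ img S.finite_F]) simp
  moreover have "card ?K \<le> 3 + card ?Q"
    using card_Un_le[of "{2,3,5::nat}" ?Q] by simp
  ultimately have "card ?K \<le> 3 + card ?F" by simp
  then have "real (card ?K) \<le> 3 + real (card ?F)" by simp
  then have cardK: "real (card ?K) * M \<le> (3 + 6 / 19 * R) * M"
    using card_rough_sets[OF R] M by (intro mult_right_mono) simp_all
  have "(\<Sum>p | prime p \<and> real p \<in> {a..b}. f (real p)) \<le> real (card ?K) * M +
      (\<Sum>n | coprime n 30 \<and> a \<le> real n \<and> real n \<le> b. f (real n) * ?W n)"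
  proof (rule sum_primes_le_weighted[OF f])
    fix p :: nat assume p: "prime p" "p \<notin> ?K"
    have "coprime p 30" using p prime_less_7[of p] coprime_30_iff[of p] by force
    moreover have "?W p = 1" using S.lam_sum_prime[of p] p by simp
    ultimately show "coprime p 30 \<and> ?W p = 1" by simp
  qed (use M finQ in auto)
  also have "\<dots> \<le> real (card ?K) * M + (4 / 15 * integral {a..b} f / S.L
      + 14 / 15 * ?V * (\<Sum>A\<in>?F. \<bar>S.lam A\<bar>)\<^sup>2)"
  proof (intro add_left_mono S.weighted_sum_le[OF wheel_30 a ab W])
    show "coprime p 30" if "A \<in> ?F" "p \<in> A" for A p
      using that coprime_30_iff[of p] by (auto simp: rough_sets_def)
  qed
  also have "\<dots> \<le> (3 + 6 / 19 * R) * M + (4 / 15 * integral {a..b} f / S.L + 14 / 15 * ?V * (S / S.L)\<^sup>2)"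
  proof (intro add_mono cardK order_refl mult_left_mono power_mono)
    show "(\<Sum>A\<in>?F. \<bar>S.lam A\<bar>) \<le> S / S.L"
      unfolding S.sum_abs_lam using S S.L_pos by (intro divide_right_mono) auto
    have "h absolutely_integrable_on {a..b}" using W by (simp add: W11_def)
    then show "0 \<le> 14 / 15 * ?V" using L1norm_nonneg by simp
  qed (auto intro: sum_nonneg)
  finally show ?thesis by (simp add: L_def)
qed

lemma abs_le_supnorm:
  assumes "continuous_on {a..b} f" "t \<in> {a..b}"
  shows "\<bar>f t\<bar> \<le> supnorm {a..b} f"
proof -
  have "compact ((\<lambda>t. \<bar>f t\<bar>) ` {a..b})"
    by (intro compact_continuous_image continuous_on_rabs assms compact_Icc)
  then have "bdd_above ((\<lambda>t. \<bar>f t\<bar>) ` {a..b})"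
    by (intro bounded_imp_bdd_above compact_imp_bounded)
  then show ?thesis unfolding supnorm_def using assms(2) by (intro cSup_upper imageI)
qed

theorem theorem4p3:
  fixes x y :: real and f h :: "real \<Rightarrow> real"
  assumes "x \<ge> 0" and "y > 0"
    and "W11 {x..x+y} f h"
    and "\<forall>t\<in>{x..x+y}. f t \<ge> 0"
    and "rho {x..x+y} f h > 1"
  shows "(\<Sum>p\<in>{p::nat. prime p \<and> real p \<in> {x..x+y}}. f (real p))
           < 2 * L1norm {x..x+y} f / ln (rho {x..x+y} f h)"
proof -
  let ?I = "{x..x+y}"
  let ?V = "\<bar>f x\<bar> + \<bar>f (x+y)\<bar> + L1norm ?I h"
  define M where "M = supnorm ?I f"
  define E where "E = M + L1norm ?I h"
  define \<rho> where "\<rho> = rho ?I f h"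
  have xy: "x < x + y" using assms by simp
  note W = assms(3)
  have contf: "continuous_on ?I f" and "h absolutely_integrable_on ?I"
    using W by (auto simp: W11_def)
  then have h0: "L1norm ?I h \<ge> 0" by (intro L1norm_nonneg)
  have fM: "0 \<le> f t \<and> f t \<le> M" if "t \<in> ?I" for t
    using abs_le_supnorm[OF contf that] assms(4) that by (auto simp: M_def)
  have M0: "M \<ge> 0" using fM[of x] xy by simp
  have ME: "M \<le> E" using h0 by (simp add: E_def)
  have V: "?V \<le> 2 * E" using fM[of x] fM[of "x+y"] xy h0 by (simp add: E_def)
  have \<rho>1: "\<rho> > 1" using assms(5) by (simp add: \<rho>_def)
  have "\<rho> = L1norm ?I f / E"
    using \<rho>1 by (auto simp: \<rho>_def rho_def E_def M_def split: if_splits)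
  moreover from this have E0: "E > 0" using \<rho>1 M0 ME by (cases "E = 0") auto
  ultimately have A: "L1norm ?I f = \<rho> * E" by simp
  have "L1norm ?I f = integral ?I f"
    unfolding L1norm_def by (rule integral_cong) (use assms(4) in auto)
  then have iA: "integral ?I f = \<rho> * E" using A by simp
  have "(\<Sum>p | prime p \<and> real p \<in> ?I. f (real p)) < (2 * \<rho> / ln \<rho>) * E"
  proof -
    consider "\<rho> \<le> 30" | "30 \<le> \<rho>" "\<rho> \<le> 1024" | "1024 \<le> \<rho>" by linarith
    then show ?thesis
    proof cases
      case 1
      have "(\<Sum>p | prime p \<and> real p \<in> ?I. f (real p))
          \<le> real (card {2::nat}) * M + 1 / 2 * integral ?I f + 1 / 2 * ?V"
      proof (rule sum_primes_le_wheel[OF wheel_2 assms(1) xy W fM M0])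
        show "coprime p 2" if "prime p" "p \<notin> {2}" for p :: nat
          using that prime_ge_2_nat[of p] prime_odd_nat[of p] by (simp add: coprime_right_2_iff_odd)
      qed auto
      also have "\<dots> \<le> (\<rho> / 2 + 2) * E"
        using ME V by (simp add: iA algebra_simps)
      also have "\<dots> < (2 * \<rho> / ln \<rho>) * E"
        by (rule mult_strict_right_mono[OF small_rho_odd[OF \<rho>1 1] E0])
      finally show ?thesis .
    next
      case 2
      have "(\<Sum>p | prime p \<and> real p \<in> ?I. f (real p))
          \<le> real (card {2,3,5::nat}) * M + 4 / 15 * integral ?I f + 14 / 15 * ?V"
      proof (rule sum_primes_le_wheel[OF wheel_30 assms(1) xy W fM M0])
        show "coprime p 30" if "prime p" "p \<notin> {2,3,5}" for p :: nat
          using that prime_less_7[of p] coprime_30_iff[of p] by force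
      qed auto
      also have "\<dots> \<le> (4 / 15 * \<rho> + 28 / 15 + 3) * E"
        using ME V by (simp add: iA algebra_simps)
      also have "\<dots> < (2 * \<rho> / ln \<rho>) * E"
        by (rule mult_strict_right_mono[OF medium_rho_wheel_30[OF 2] E0])
      finally show ?thesis .
    next
      case 3
      define l where "l = ln \<rho> / 2"
      define R where "R = 11 / 32 * exp l"
      let ?L = "selberg_sieve.L (rough_sets R)"
      have "exp l * exp l = \<rho>" using 3 by (simp add: l_def flip: exp_add)
      have "exp l \<ge> 32"
      proof (rule ccontr)
        assume "\<not> exp l \<ge> 32"
        then have "exp l * exp l < 32 * 32" by (intro mult_strict_mono') auto
        then show False using 3 \<open>exp l * exp l = \<rho>\<close> by simp
      qed
      then have R: "R \<ge> 11" by (simp add: R_def)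
      have "(\<Sum>p | prime p \<and> real p \<in> ?I. f (real p))
          \<le> (3 + 6 / 19 * R) * M + 4 / 15 * integral ?I f / ?L + 14 / 15 * ?V * (12 / 25 * R / ?L)\<^sup>2"
        by (rule sum_primes_le_selberg[OF R assms(1) xy W fM M0 sum_prod_le_rough_sets[OF R]])
      also have "\<dots> \<le> (3 + 6 / 19 * R) * E + 4 / 15 * integral ?I f / ?L
          + 14 / 15 * (2 * E) * (12 / 25 * R / ?L)\<^sup>2"
        using ME V R by (intro add_mono mult_left_mono mult_right_mono order_refl) auto
      also have "\<dots> = (3 + 6 / 19 * R + 4 / 15 * \<rho> / ?L + 28 / 15 * (12 / 25 * R / ?L)\<^sup>2) * E"
        by (simp add: iA algebra_simps)
      also have "\<dots> < (2 * \<rho> / ln \<rho>) * E"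
        by (rule mult_strict_right_mono[OF large_rho_selberg[OF 3 l_def R_def L_rough_sets_ge[OF R]] E0])
      finally show ?thesis .
    qed
  qed
  then show ?thesis by (simp add: A \<rho>_def)
qed

end
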